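(* For every group $G$ of order $32$ that is isomorphic to neither $G_{44}$ nor $G_{45}$, one has $\mathrm{Aut}_c(G)=\mathrm{Inn}(G)$; and for $G=G_{44}$ and $G=G_{45}$ one has $\mathrm{Aut}_c(G)\neq\mathrm{Inn}(G)$.
   Context: $\mathrm{Inn}(G)$ is the group of inner automorphisms of $G$. $\mathrm{Aut}_c(G)$ is the group of all class preserving automorphisms of $G$, i.e. automorphisms $\alpha$ such that $\alpha(x)$ is conjugate to $x$ in $G$ for every $x\in G$. Commutators are $[a,b]=a^{-1}b^{-1}ab$. The groups $G_{44}$ and $G_{45}$ are the groups numbered 44 and 45 in the Hall–Senior (equivalently Sag–Wamsley) list of the 51 groups of order 32; they are the two groups of order 32 constituting the sixth isoclinism family $\Phi_6$. They are the following groups of order 32: $$G_{44}=\langle x,y,z \mid x^2=z^2=1,\ [y,x]y^4=1,\ [y,z]y^2=1,\ [x,z]=1\rangle,$$ $$G_{45}=\langle x,y,z \mid x^2=1,\ z^2=y^4,\ [y,x]y^4=1,\ [y,z]y^2=1,\ [x,z]=1\rangle.$$ (In both groups $y$ has order 8, $x^{-1}yx=y^5$ and $z^{-1}yz=y^{-1}$.) *)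

theory Defs
  imports "HOL-Algebra.Algebra"
begin

section \<open>Inner and class preserving automorphisms\<close>

text \<open>
  Automorphisms are those of \<^const>\<open>auto\<close>, that is, they are extensional functions. Hence two of
  them are equal as soon as they agree on the carrier, and the subgroups \<open>Inn G\<close> and \<open>Aut_c G\<close> of
  \<^term>\<open>AutoGroup G\<close> are given by their sets of elements.
\<close>

definition Inn :: "('a, 'b) monoid_scheme \<Rightarrow> ('a \<Rightarrow> 'a) set" where
  "Inn G = {\<lambda>x\<in>carrier G. inv\<^bsub>G\<^esub> g \<otimes>\<^bsub>G\<^esub> x \<otimes>\<^bsub>G\<^esub> g | g. g \<in> carrier G}"

definition conjugate_in :: "('a, 'b) monoid_scheme \<Rightarrow> 'a \<Rightarrow> 'a \<Rightarrow> bool" where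
  "conjugate_in G x y \<longleftrightarrow> (\<exists>g\<in>carrier G. y = inv\<^bsub>G\<^esub> g \<otimes>\<^bsub>G\<^esub> x \<otimes>\<^bsub>G\<^esub> g)"

definition Aut_c :: "('a, 'b) monoid_scheme \<Rightarrow> ('a \<Rightarrow> 'a) set" where
  "Aut_c G = {\<alpha> \<in> auto G. \<forall>x\<in>carrier G. conjugate_in G (\<alpha> x) x}"

definition commutator :: "('a, 'b) monoid_scheme \<Rightarrow> 'a \<Rightarrow> 'a \<Rightarrow> 'a" where
  "commutator G a b = inv\<^bsub>G\<^esub> a \<otimes>\<^bsub>G\<^esub> inv\<^bsub>G\<^esub> b \<otimes>\<^bsub>G\<^esub> a \<otimes>\<^bsub>G\<^esub> b"

lemma (in group) Inn_subset_Aut_c: "Inn G \<subseteq> Aut_c G"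
proof
  fix f assume "f \<in> Inn G"
  then obtain g where g: "g \<in> carrier G" and f: "f = (\<lambda>x\<in>carrier G. inv g \<otimes> x \<otimes> g)"
    unfolding Inn_def by auto
  have c: "g \<otimes> (inv g \<otimes> a) = a" "inv g \<otimes> (g \<otimes> a) = a" if "a \<in> carrier G" for a
    using that g by (simp_all flip: m_assoc)
  have hom: "f \<in> hom G G"
  proof (rule homI)
    fix x y assume "x \<in> carrier G" "y \<in> carrier G"
    then show "f (x \<otimes> y) = f x \<otimes> f y"
      using g by (simp add: f m_assoc c)
  qed (simp add: f g)
  have "bij_betw f (carrier G) (carrier G)"
    by (rule bij_betw_byWitness[where f' = "\<lambda>x. g \<otimes> x \<otimes> inv g"])
       (use g in \<open>auto simp: f m_assoc c\<close>)
  moreover have "conjugate_in G (f x) x" if "x \<in> carrier G" for x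
    unfolding conjugate_in_def
    using that g by (intro bexI[of _ "inv g"]) (auto simp: f m_assoc c)
  ultimately show "f \<in> Aut_c G"
    using hom by (auto simp: Aut_c_def auto_def Bij_def f)
qed


section \<open>Free groups and presentations\<close>

text \<open>
  The free group on the type \<open>'g\<close> consists of words in the letters \<open>(a, True)\<close>, standing for \<open>a\<close>,
  and \<open>(a, False)\<close>, standing for the formal inverse of \<open>a\<close>, modulo insertion and deletion of
  mutually inverse neighbours.
\<close>

type_synonym 'g word = "('g \<times> bool) list"

inductive free_eq :: "'g word \<Rightarrow> 'g word \<Rightarrow> bool" where
  refl: "free_eq u u"
| sym: "free_eq u v \<Longrightarrow> free_eq v u"
| trans: "free_eq u v \<Longrightarrow> free_eq v w \<Longrightarrow> free_eq u w"
| cancel: "free_eq (u @ (a, b) # (a, \<not> b) # v) (u @ v)"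

definition word_class :: "'g word \<Rightarrow> 'g word set" where
  "word_class u = {v. free_eq u v}"

definition free_group :: "('g word set) monoid" where
  "free_group =
    \<lparr>carrier = range word_class,
     monoid.mult = (\<lambda>A B. \<Union>u\<in>A. \<Union>v\<in>B. word_class (u @ v)),
     one = word_class []\<rparr>"

definition free_gen :: "'g \<Rightarrow> 'g word set" where
  "free_gen a = word_class [(a, True)]"

definition normal_closure :: "('a, 'b) monoid_scheme \<Rightarrow> 'a set \<Rightarrow> 'a set" where
  "normal_closure G R =
    generate G {g \<otimes>\<^bsub>G\<^esub> r \<otimes>\<^bsub>G\<^esub> inv\<^bsub>G\<^esub> g | g r. g \<in> carrier G \<and> r \<in> R}"

definition presented_group :: "'g word set set \<Rightarrow> ('g word set set) monoid" where
  "presented_group R = free_group Mod normal_closure free_group R"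

lemma word_class_eq_iff: "word_class u = word_class v \<longleftrightarrow> free_eq u v"
  proof
  assume "word_class u = word_class v"
  moreover have "v \<in> word_class v" by (simp add: word_class_def free_eq.refl)
  ultimately have "v \<in> word_class u" by simp
  then show "free_eq u v" by (simp add: word_class_def)
next
  assume "free_eq u v"
  then show "word_class u = word_class v"
    unfolding word_class_def by (blast intro: free_eq.sym free_eq.trans)
qed

lemma free_eq_append_right: "free_eq u v \<Longrightarrow> free_eq (u @ w) (v @ w)"
proof (induction rule: free_eq.induct)
  case (cancel u a b v)
  show ?case using free_eq.cancel[of u a b "v @ w"] by simp
next
  case (trans u v x)
  then show ?case by (blast intro: free_eq.trans)
qed (simp_all add: free_eq.refl free_eq.sym)

lemma free_eq_append_left: "free_eq u v \<Longrightarrow> free_eq (w @ u) (w @ v)"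
proof (induction rule: free_eq.induct)
  case (cancel u a b v)
  show ?case using free_eq.cancel[of "w @ u" a b v] by simp
next
  case (trans u v x)
  then show ?case by (blast intro: free_eq.trans)
qed (simp_all add: free_eq.refl free_eq.sym)

lemma free_group_mult:
  "word_class u \<otimes>\<^bsub>free_group\<^esub> word_class v = word_class (u @ v)"
proof -
  have "word_class (u' @ v') = word_class (u @ v)"
    if "u' \<in> word_class u" "v' \<in> word_class v" for u' v'
    using that unfolding word_class_def mem_Collect_eq
    by (metis word_class_eq_iff word_class_def free_eq_append_left free_eq_append_right)
  then have "(\<Union>u'\<in>word_class u. \<Union>v'\<in>word_class v. word_class (u' @ v'))
      = (\<Union>u'\<in>word_class u. \<Union>v'\<in>word_class v. word_class (u @ v))"
    by (intro SUP_cong) auto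
  moreover have "word_class u \<noteq> {}" "word_class v \<noteq> {}"
    by (auto simp: word_class_def intro: free_eq.refl)
  ultimately show ?thesis
    unfolding free_group_def by simp
qed

lemma free_group_one: "\<one>\<^bsub>free_group\<^esub> = word_class []"
  by (simp add: free_group_def)

lemma free_group_carrier: "carrier free_group = range word_class"
  by (simp add: free_group_def)

definition word_inv :: "'g word \<Rightarrow> 'g word" where
  "word_inv u = rev (map (\<lambda>(a, b). (a, \<not> b)) u)"

lemma word_inv_left: "free_eq (word_inv u @ u) []"
proof (induction u)
  case Nil
  show ?case by (simp add: word_inv_def free_eq.refl)
next
  case (Cons l u)
  obtain a b where l: "l = (a, b)" by (cases l)
  have "free_eq (word_inv u @ (a, \<not> b) # (a, \<not> \<not> b) # u) (word_inv u @ u)"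
    by (rule free_eq.cancel)
  then show ?case
    using free_eq.trans[OF _ Cons] by (simp add: l word_inv_def)
qed

lemma group_free_group: "group (free_group :: 'g word set monoid)"
proof (rule groupI)
  fix x :: "'g word set" assume "x \<in> carrier free_group"
  then obtain u where u: "x = word_class u" by (auto simp: free_group_carrier)
  show "\<exists>y\<in>carrier free_group. y \<otimes>\<^bsub>free_group\<^esub> x = \<one>\<^bsub>free_group\<^esub>"
    by (rule bexI[of _ "word_class (word_inv u)"])
       (auto simp: u free_group_mult free_group_one free_group_carrier
          word_class_eq_iff word_inv_left)
qed (auto simp: free_group_carrier free_group_mult free_group_one)

lemma (in group) normal_closure_normal:
  assumes R: "R \<subseteq> carrier G"
  shows "normal_closure G R \<lhd> G"
  unfolding normal_closure_def
proof (rule normal_generateI)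
  fix h g assume "h \<in> {g \<otimes> r \<otimes> inv g | g r. g \<in> carrier G \<and> r \<in> R}" and g: "g \<in> carrier G"
  then obtain k r where k: "k \<in> carrier G" "r \<in> R" and h: "h = k \<otimes> r \<otimes> inv k" by auto
  then have "g \<otimes> h \<otimes> inv g = (g \<otimes> k) \<otimes> r \<otimes> inv (g \<otimes> k)"
    using R g by (auto simp: m_assoc inv_mult_group subset_iff)
  then show "g \<otimes> h \<otimes> inv g \<in> {g \<otimes> r \<otimes> inv g | g r. g \<in> carrier G \<and> r \<in> R}"
    using g k by blast
qed (use R in auto)

lemma group_presented_group:
  "R \<subseteq> carrier free_group \<Longrightarrow> group (presented_group R)"
  unfolding presented_group_def
  by (intro normal.factorgroup_is_group group.normal_closure_normal group_free_group)


section \<open>The two groups of the sixth isoclinism family\<close>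

datatype gen = gen_x | gen_y | gen_z

definition G44 :: "gen word set set monoid" where
  "G44 =
    (let F = free_group; x = free_gen gen_x; y = free_gen gen_y; z = free_gen gen_z
     in presented_group
       {x [^]\<^bsub>F\<^esub> (2::nat),
        z [^]\<^bsub>F\<^esub> (2::nat),
        commutator F y x \<otimes>\<^bsub>F\<^esub> y [^]\<^bsub>F\<^esub> (4::nat),
        commutator F y z \<otimes>\<^bsub>F\<^esub> y [^]\<^bsub>F\<^esub> (2::nat),
        commutator F x z})"

text \<open>The relation \<open>z\<^sup>2 = y\<^sup>4\<close> is rendered as the relator \<open>z\<^sup>2 \<otimes> inv (y\<^sup>4)\<close>.\<close>

definition G45 :: "gen word set set monoid" where
  "G45 =
    (let F = free_group; x = free_gen gen_x; y = free_gen gen_y; z = free_gen gen_z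
     in presented_group
       {x [^]\<^bsub>F\<^esub> (2::nat),
        z [^]\<^bsub>F\<^esub> (2::nat) \<otimes>\<^bsub>F\<^esub> inv\<^bsub>F\<^esub> (y [^]\<^bsub>F\<^esub> (4::nat)),
        commutator F y x \<otimes>\<^bsub>F\<^esub> y [^]\<^bsub>F\<^esub> (4::nat),
        commutator F y z \<otimes>\<^bsub>F\<^esub> y [^]\<^bsub>F\<^esub> (2::nat),
        commutator F x z})"

end

(*
  A group of order 32 without a noncentral element whose centralizer C has index 2 is abelian
  (count conjugacy classes). If such a C is abelian, a class preserving automorphism fixing some
  t outside C restricts on C to a map that is pointwise either the identity or conjugation by t; as C
  is not a union of two proper subgroups, it is one of the two globally, so the automorphism is inner.

  Otherwise Z(G) = {1, z}, Z(C) = {1, z, u, uz} and C' = {1, z}, and the same argument modulo z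
  leaves automorphisms f with f(t) = t and f(c) = c or cz on C. Those fixing u agree on C with
  conjugation by some d in C, and unless f is inner d has order 8. If f(u) = uz, either conjugation by t
  reduces to the previous case or an element of order 8 outside C is found. In either case G
  contains y of order 8 such that conjugation by elements of G induces every automorphism of <y>, and
  suitable x, z in G then satisfy with y the relations of G44 or G45. Both groups are compared with an explicit model on triples
  (i, j, k), standing for y^i x^j z^k, where z -> z y^2 (x and y fixed) is class preserving
  but not inner.
*)
theory Submission
  imports Defs
begin

section \<open>A model of the two exceptional groups\<close>

text \<open>What is lost modulo z is a homomorphism from C to {1, z}. As C/Z(C) has order 4 and C' =
  {1, z}, conjugations by elements of C realise precisely the homomorphisms that are trivial on
  Z(C). Since z is always fixed, f(u) is the only obstruction to being such a conjugation; this is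
  why the cases are split by it. Counting classes alone does not produce C: it leaves a centre of
  order 4 with all other centralizers of order 8. That case falls because commutation would be an
  alternating bilinear map from F_2^3 to F_2^2, and such a map vanishes on some independent pair.
  The exceptional groups appear because 5 and -1 generate the units modulo 8. Once all units are
  induced on <y>, this subgroup is its own centralizer in order 32, so for elements x and z inducing
  5 and -1 the values x^2, z^2 and [x, z] are powers of y. Changing x and z by powers of y removes
  all of them except possibly z^2 = y^4, which is the parameter \<open>e\<close>.\<close>

definition model_act :: "bool \<Rightarrow> bool \<Rightarrow> int" where
  "model_act j k = (if j then 5 else 1) * (if k then - 1 else 1)"

text \<open>An extension of (Z/2)^2 by Z/8. Moving x^j z^k past y costs the factor
  \<open>model_act j k\<close>, which runs through 1, 5, -1, -5, the units modulo 8. The summand 4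
  is the cocycle for z^2 = y^4: \<open>e\<close> is False for G44 and True for G45.\<close>

definition model :: "bool \<Rightarrow> (int \<times> bool \<times> bool) monoid" where
  "model e =
    \<lparr>carrier = {0..<8} \<times> UNIV,
     monoid.mult = (\<lambda>(i, j, k) (i', j', k').
       ((i + model_act j k * i' + (if e \<and> k \<and> k' then 4 else 0)) mod 8, j \<noteq> j', k \<noteq> k')),
     one = (0, False, False)\<rparr>"

lemma model_carrier: "(i, j, k) \<in> carrier (model e) \<longleftrightarrow> 0 \<le> i \<and> i < 8"
  by (auto simp: model_def)

lemma model_mult: "(i, j, k) \<otimes>\<^bsub>model e\<^esub> (i', j', k') =
    ((i + model_act j k * i' + (if e \<and> k \<and> k' then 4 else 0)) mod 8, j \<noteq> j', k \<noteq> k')"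
  by (simp add: model_def)

lemma model_one: "\<one>\<^bsub>model e\<^esub> = (0, False, False)"
  by (simp add: model_def)

lemma card_model: "order (model e) = 32"
  by (simp add: model_def order_def card_cartesian_product flip: UNIV_Times_UNIV)

lemma mod_add_mult_add:
  fixes a b c d m :: int
  shows "(a mod m + d * b + c) mod m = (a + d * b + c) mod m"
    and "(a + d * (b mod m) + c) mod m = (a + d * b + c) mod m"
    and "(a mod m + d * (b mod m) + c) mod m = (a + d * b + c) mod m"
  by (rule mod_add_cong[OF mod_add_cong[OF mod_mod_trivial HOL.refl] HOL.refl]
      mod_add_cong[OF mod_add_cong[OF HOL.refl mod_mult_right_eq] HOL.refl]
      mod_add_cong[OF mod_add_cong[OF mod_mod_trivial mod_mult_right_eq] HOL.refl])+

lemma group_model: "group (model e)"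
proof (rule groupI)
  fix a b c assume "a \<in> carrier (model e)" "b \<in> carrier (model e)" "c \<in> carrier (model e)"
  obtain i j k where a: "a = (i, j, k)" by (cases a)
  obtain i' j' k' where b: "b = (i', j', k')" by (cases b)
  obtain i'' j'' k'' where c: "c = (i'', j'', k'')" by (cases c)
  show "a \<otimes>\<^bsub>model e\<^esub> b \<otimes>\<^bsub>model e\<^esub> c = a \<otimes>\<^bsub>model e\<^esub> (b \<otimes>\<^bsub>model e\<^esub> c)"
  proof -
    define d d' where "d = model_act j k" and "d' = model_act j' k'"
    define t where "t = (\<lambda>k k'. if e \<and> k \<and> k' then 4 else 0 :: int)"
    \<comment> \<open>The action is multiplicative modulo 8 only, because 5^2 is 1 there.\<close>
    have "8 dvd model_act (j \<noteq> j') (k \<noteq> k') - d * d'"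
      by (simp add: d_def d'_def model_act_def)
    then have "8 dvd (model_act (j \<noteq> j') (k \<noteq> k') - d * d') * i''" by simp
    \<comment> \<open>Cocycle identity: \<open>d\<close> is odd, so it fixes 4 modulo 8, and
      \<open>t\<close> is 4 times a product of parities, hence additive in both arguments modulo
      8.\<close>
    moreover have "8 dvd t k k' + t (k \<noteq> k') k'' - (d * t k' k'' + t k (k' \<noteq> k''))"
      by (simp add: d_def t_def model_act_def)
    ultimately have "8 dvd (model_act (j \<noteq> j') (k \<noteq> k') - d * d') * i''
        + (t k k' + t (k \<noteq> k') k'' - (d * t k' k'' + t k (k' \<noteq> k'')))"
      by (rule dvd_add)
    also have "\<dots> = (i + d * i' + t k k' + model_act (j \<noteq> j') (k \<noteq> k') * i'' + t (k \<noteq> k') k'')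
        - (i + d * (i' + d' * i'' + t k' k'') + t k (k' \<noteq> k''))"
      by (simp add: algebra_simps)
    finally have "(i + d * i' + t k k' + model_act (j \<noteq> j') (k \<noteq> k') * i'' + t (k \<noteq> k') k'') mod 8
        = (i + d * (i' + d' * i'' + t k' k'') + t k (k' \<noteq> k'')) mod 8"
      by (simp only: mod_eq_dvd_iff)
    then have "((i + d * i' + t k k') mod 8 + model_act (j \<noteq> j') (k \<noteq> k') * i'' + t (k \<noteq> k') k'') mod 8
        = (i + d * ((i' + d' * i'' + t k' k'') mod 8) + t k (k' \<noteq> k'')) mod 8"
      unfolding mod_add_mult_add(1)[of "i + d * i' + t k k'"]
        mod_add_mult_add(2)[of i d "i' + d' * i'' + t k' k''"] .
    then show ?thesis
      unfolding a b c model_mult prod.inject d_def d'_def t_def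
      by (intro conjI) (assumption, blast+)
  qed
next
  fix a assume "a \<in> carrier (model e)"
  then obtain i j k where a: "a = (i, j, k)" "0 \<le> i" "i < 8" by (cases a) (auto simp: model_carrier)
  show "\<exists>b\<in>carrier (model e). b \<otimes>\<^bsub>model e\<^esub> a = \<one>\<^bsub>model e\<^esub>"
  proof
    \<comment> \<open>The first component solves i' + d i + c = 0 modulo 8, with d the action and c
      the cocycle value; c may be put inside the bracket since d c = c modulo 8 for odd d.\<close>
    show "((- (model_act j k * (i + (if e \<and> k then 4 else 0)))) mod 8, j, k) \<otimes>\<^bsub>model e\<^esub> a = \<one>\<^bsub>model e\<^esub>"
      unfolding a(1) model_mult model_one model_act_def
      by (cases j; cases k; cases e; simp; presburger)
  qed (simp add: model_carrier)
qed (auto simp: model_carrier model_mult model_one model_act_def)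

section \<open>Elements satisfying the relations of G44 or G45, and the normal form y^i x^j
  z^k\<close>

locale phi6_gens = group G for G (structure) +
  fixes e :: bool and x y z :: 'a
  assumes closed [simp]: "x \<in> carrier G" "y \<in> carrier G" "z \<in> carrier G"
    and y8: "y [^] (8::int) = \<one>"
    and xx: "x \<otimes> x = \<one>"
    and zz: "z \<otimes> z = (if e then y [^] (4::int) else \<one>)"
    and xy: "x \<otimes> y = y [^] (5::int) \<otimes> x"
    and zy: "z \<otimes> y = y [^] (- 1 :: int) \<otimes> z"
    and xz: "x \<otimes> z = z \<otimes> x"
begin

definition nf :: "int \<times> bool \<times> bool \<Rightarrow> 'a" where
  "nf = (\<lambda>(i, j, k). y [^] i \<otimes> ((if j then x else \<one>) \<otimes> (if k then z else \<one>)))"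

lemma y_pow_mod: "y [^] (i mod 8) = y [^] (i::int)"
proof -
  have "y [^] i = y [^] (8 * (i div 8) + i mod 8)" by simp
  also have "\<dots> = (y [^] (8::int)) [^] (i div 8) \<otimes> y [^] (i mod 8)"
    by (simp only: int_pow_mult int_pow_pow closed)
  finally show ?thesis by (simp add: y8)
qed

lemma y_pow_eqI: "i mod 8 = j mod 8 \<Longrightarrow> y [^] (i::int) = y [^] (j::int)"
  by (metis y_pow_mod)

lemma commute_pow:
  assumes "g \<in> carrier G" "g \<otimes> y = y [^] (m::int) \<otimes> g"
  shows "g \<otimes> y [^] (i::int) = y [^] (m * i) \<otimes> g"
proof -
  have "g \<otimes> y \<otimes> inv g = y [^] m" using assms by (simp add: inv_solve_right')
  interpret h: group_hom G G "\<lambda>a. g \<otimes> a \<otimes> inv g"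
    by unfold_locales (auto simp: hom_def m_assoc assms(1) inv_solve_left)
  have "g \<otimes> y [^] i \<otimes> inv g = (g \<otimes> y \<otimes> inv g) [^] i" by (rule h.hom_int_pow) simp
  also have "\<dots> = y [^] (m * i)" by (simp add: \<open>g \<otimes> y \<otimes> inv g = y [^] m\<close> int_pow_pow)
  finally show ?thesis using assms by (simp add: inv_solve_right')
qed

text \<open>The relations \<open>xy\<close> and \<open>zy\<close> carry powers of y to the left,
  \<open>xz\<close>, \<open>xx\<close> and \<open>zz\<close> collect the rest, and y^8 = 1 matches
  exponents modulo 8. The elements may satisfy further relations, so injectivity is a separate
  question.\<close>

lemma nf_hom: "nf \<in> hom (model e) G"
proof (rule homI)
  fix a b assume "a \<in> carrier (model e)" "b \<in> carrier (model e)"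
  obtain i j k where a: "a = (i, j, k)" by (cases a)
  obtain i' j' k' where b: "b = (i', j', k')" by (cases b)
  note xp = commute_pow[OF closed(1) xy] and zp = commute_pow[OF closed(3) zy]
  have L: "g \<otimes> (h \<otimes> w) = (g \<otimes> h) \<otimes> w" if "g \<in> carrier G" "h \<in> carrier G" "w \<in> carrier G" for g h w
    using that by (simp add: m_assoc)
  have xp': "x \<otimes> (y [^] i \<otimes> w) = y [^] (5 * i) \<otimes> (x \<otimes> w)" if "w \<in> carrier G" for w and i :: int
    using that by (simp add: L xp)
  have zp': "z \<otimes> (y [^] i \<otimes> w) = y [^] (- i) \<otimes> (z \<otimes> w)" if "w \<in> carrier G" for w and i :: int
    using that by (simp add: L zp)
  have yp': "y [^] i \<otimes> (y [^] i' \<otimes> w) = y [^] (i + i') \<otimes> w" if "w \<in> carrier G" for w and i i' :: int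
    using that by (simp add: L int_pow_mult)
  have xx': "x \<otimes> (x \<otimes> w) = w" if "w \<in> carrier G" for w
    using that by (simp add: L xx)
  have zz': "z \<otimes> (z \<otimes> w) = (if e then y [^] (4::int) else \<one>) \<otimes> w" if "w \<in> carrier G" for w
    using that by (simp add: L zz)
  have zx': "z \<otimes> (x \<otimes> w) = x \<otimes> (z \<otimes> w)" if "w \<in> carrier G" for w
    using that by (simp add: L xz)
  show "nf (a \<otimes>\<^bsub>model e\<^esub> b) = nf a \<otimes> nf b"
    unfolding a b model_mult model_act_def nf_def prod.case y_pow_mod
    by (cases j; cases k; cases j'; cases k'; cases e; simp add: m_assoc xp' zp' yp' xx' zz' zx' xz[symmetric] zz xx xp zp int_pow_mult[symmetric])
      (rule y_pow_eqI, simp add: mod_eq_dvd_iff algebra_simps)+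
qed (auto simp: nf_def)

end

section \<open>Conjugation and the exotic automorphism\<close>

definition (in group) cj :: "'a \<Rightarrow> 'a \<Rightarrow> 'a" where
  "cj g a = inv g \<otimes> a \<otimes> g"

context group
begin

lemma cj_closed [simp]: "g \<in> carrier G \<Longrightarrow> a \<in> carrier G \<Longrightarrow> cj g a \<in> carrier G"
  by (simp add: cj_def)

lemma l_inv_cancel [simp]:
  "g \<in> carrier G \<Longrightarrow> a \<in> carrier G \<Longrightarrow> inv g \<otimes> (g \<otimes> a) = a"
  "g \<in> carrier G \<Longrightarrow> a \<in> carrier G \<Longrightarrow> g \<otimes> (inv g \<otimes> a) = a"
  by (simp_all flip: m_assoc)

lemma cj_mult: "g \<in> carrier G \<Longrightarrow> a \<in> carrier G \<Longrightarrow> b \<in> carrier G \<Longrightarrow>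
    cj g (a \<otimes> b) = cj g a \<otimes> cj g b"
  by (simp add: cj_def m_assoc)

lemma cj_cj: "g \<in> carrier G \<Longrightarrow> h \<in> carrier G \<Longrightarrow> a \<in> carrier G \<Longrightarrow>
    cj h (cj g a) = cj (g \<otimes> h) a"
  by (simp add: cj_def m_assoc inv_mult_group)

lemma cj_one [simp]: "a \<in> carrier G \<Longrightarrow> cj \<one> a = a"
  by (simp add: cj_def)

lemma cj_of_one [simp]: "g \<in> carrier G \<Longrightarrow> cj g \<one> = \<one>"
  by (simp add: cj_def)

lemma cj_inv [simp]: "g \<in> carrier G \<Longrightarrow> a \<in> carrier G \<Longrightarrow> cj g (cj (inv g) a) = a"
  "g \<in> carrier G \<Longrightarrow> a \<in> carrier G \<Longrightarrow> cj (inv g) (cj g a) = a"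
  by (simp_all add: cj_cj)

lemma cj_hom: "g \<in> carrier G \<Longrightarrow> group_hom G G (cj g)"
  by unfold_locales (auto simp: hom_def cj_mult)

lemma cj_of_inv: "g \<in> carrier G \<Longrightarrow> a \<in> carrier G \<Longrightarrow> cj g (inv a) = inv (cj g a)"
  by (rule group_hom.hom_inv[OF cj_hom])

lemma cj_int_pow: "g \<in> carrier G \<Longrightarrow> a \<in> carrier G \<Longrightarrow> cj g (a [^] (i::int)) = cj g a [^] i"
  by (rule group_hom.hom_int_pow[OF cj_hom])

lemma cj_eq_iff: "g \<in> carrier G \<Longrightarrow> a \<in> carrier G \<Longrightarrow> b \<in> carrier G \<Longrightarrow>
    cj g a = b \<longleftrightarrow> a \<otimes> g = g \<otimes> b"
  by (auto simp: cj_def m_assoc inv_solve_left')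

lemma commute_mult:
  "a \<in> carrier G \<Longrightarrow> b \<in> carrier G \<Longrightarrow> c \<in> carrier G \<Longrightarrow>
    a \<otimes> c = c \<otimes> a \<Longrightarrow> b \<otimes> c = c \<otimes> b \<Longrightarrow> (a \<otimes> b) \<otimes> c = c \<otimes> (a \<otimes> b)"
  by (metis m_assoc)

text \<open>The exponent -3 is what the relator [y, x] y^4 yields before the order of y is known.
  Since x is an involution, y equals y^9, and this is the source of y^8 = 1; only then do -3 and 5
  agree.\<close>

lemma phi6_gensI:
  assumes c [simp]: "x \<in> carrier G" "y \<in> carrier G" "z \<in> carrier G"
    and xx: "x \<otimes> x = \<one>"
    and zz: "z \<otimes> z = (if e then y [^] (4::int) else \<one>)"
    and yx: "cj x y = y [^] (- 3 :: int)"
    and yz: "cj z y = y [^] (- 1 :: int)"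
    and xz: "x \<otimes> z = z \<otimes> x"
  shows "phi6_gens G e x y z"
proof unfold_locales
  have "y = cj (x \<otimes> x) y" by (simp add: xx)
  also have "\<dots> = y [^] (9::int)"
    by (simp add: yx cj_int_pow int_pow_pow flip: cj_cj)
  also have "\<dots> = y [^] (1 + 8 :: int)" by simp
  also have "\<dots> = y \<otimes> y [^] (8::int)" by (simp only: int_pow_mult c int_pow_1)
  finally show y8: "y [^] (8::int) = \<one>" by simp
  have "y [^] (5::int) = y [^] (8::int) \<otimes> y [^] (- 3::int)" by (subst int_pow_mult[symmetric]) auto
  then have y5: "y [^] (5::int) = y [^] (- 3::int)" by (simp add: y8)
  have "cj x (y [^] (5::int)) = cj (x \<otimes> x) y"
    by (simp only: y5 yx[symmetric] cj_cj c)
  then show "x \<otimes> y = y [^] (5::int) \<otimes> x"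
    by (simp add: xx cj_eq_iff)
  have "cj z (y [^] (- 1 :: int)) = y"
    by (simp add: cj_int_pow yz int_pow_pow)
  then show "z \<otimes> y = y [^] (- 1 :: int) \<otimes> z"
    by (simp add: cj_eq_iff)
qed (use assms in auto)

end

lemma (in group) commutator_closed [simp]:
  "a \<in> carrier G \<Longrightarrow> b \<in> carrier G \<Longrightarrow> commutator G a b \<in> carrier G"
  by (simp add: commutator_def)

text \<open>The map sends z to z y^2 = y^6 z, so it adds 6 to the exponent of y exactly when
  \<open>k\<close> holds. On each single element it is conjugation by a power of y, but elements
  involving z and those involving x z need different powers.\<close>

lemma model_exotic: "Aut_c (model e) \<noteq> Inn (model e)"
proof -
  interpret group "model e" by (rule group_model)
  define t :: "bool \<Rightarrow> int" where "t k = (if k then 6 else 0)" for k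
  define \<alpha> where "\<alpha> = (\<lambda>a\<in>carrier (model e). case a of (i, j, k) \<Rightarrow> ((i + t k) mod 8, j, k))"
  have \<alpha>_eq: "\<alpha> (i, j, k) = ((i + t k) mod 8, j, k)" if "0 \<le> i" "i < 8" for i j k
    using that by (simp add: \<alpha>_def model_carrier)
  have hom: "\<alpha> \<in> hom (model e) (model e)"
  proof (rule homI)
    fix a b assume ab: "a \<in> carrier (model e)" "b \<in> carrier (model e)"
    obtain i j k where a: "a = (i, j, k)" by (cases a)
    obtain i' j' k' where b: "b = (i', j', k')" by (cases b)
    define c :: int where "c = (if e \<and> k \<and> k' then 4 else 0)"
    \<comment> \<open>\<open>t\<close> is a crossed homomorphism modulo 8 for the action on <y>. The
      cocycle value \<open>c\<close> depends on \<open>k\<close> and \<open>k'\<close> alone, which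
      the map does not change.\<close>
    have "8 dvd t (k \<noteq> k') - t k - model_act j k * t k'"
      by (simp add: t_def model_act_def)
    also have "\<dots> = (i + model_act j k * i' + c + t (k \<noteq> k')) - (i + t k + model_act j k * (i' + t k') + c)"
      by (simp add: algebra_simps)
    finally have "(i + model_act j k * i' + c + t (k \<noteq> k')) mod 8
        = (i + t k + model_act j k * (i' + t k') + c) mod 8"
      by (simp only: mod_eq_dvd_iff)
    then have "((i + model_act j k * i' + c) mod 8 + t (k \<noteq> k')) mod 8
        = ((i + t k) mod 8 + model_act j k * ((i' + t k') mod 8) + c) mod 8"
      unfolding mod_add_left_eq[of "i + model_act j k * i' + c"]
        mod_add_mult_add(3)[of "i + t k" _ _ "i' + t k'"] .
    moreover have "\<alpha> (a \<otimes>\<^bsub>model e\<^esub> b)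
        = (((i + model_act j k * i' + c) mod 8 + t (k \<noteq> k')) mod 8, j \<noteq> j', k \<noteq> k')"
      unfolding a b model_mult c_def by (rule \<alpha>_eq) simp_all
    moreover have "\<alpha> a \<otimes>\<^bsub>model e\<^esub> \<alpha> b
        = (((i + t k) mod 8 + model_act j k * ((i' + t k') mod 8) + c) mod 8, j \<noteq> j', k \<noteq> k')"
      using ab unfolding a b c_def model_carrier by (auto simp only: \<alpha>_eq model_mult)
    ultimately show "\<alpha> (a \<otimes>\<^bsub>model e\<^esub> b) = \<alpha> a \<otimes>\<^bsub>model e\<^esub> \<alpha> b" by (simp only:)
  next
    fix a assume "a \<in> carrier (model e)"
    then show "\<alpha> a \<in> carrier (model e)" by (cases a) (auto simp: \<alpha>_def model_carrier)
  qed
  have "bij_betw \<alpha> (carrier (model e)) (carrier (model e))"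
  proof (rule bij_betw_byWitness[where f' = "\<lambda>(i, j, k). ((i - t k) mod 8, j, k)"])
    show "\<alpha> ` carrier (model e) \<subseteq> carrier (model e)" using hom by (auto simp: hom_def)
  qed (auto simp: \<alpha>_eq model_carrier mod_simps)
  then have "\<alpha> \<in> auto (model e)"
    using hom by (auto simp: auto_def Bij_def \<alpha>_def)
  moreover have "conjugate_in (model e) (\<alpha> a) a" if a: "a \<in> carrier (model e)" for a
  proof -
    obtain i j k where ijk: "a = (i, j, k)" by (cases a)
    \<comment> \<open>For g = y^n and \<open>k\<close> true the condition is 6 + d n = n modulo 8,
      where d is the action of a: n = 7 solves it for d = -1, and n = 1 for d = -5.\<close>
    define g where "g = (if k then if j then 1 else 7 else 0 :: int, False, False)"
    have g: "g \<in> carrier (model e)" by (auto simp: g_def model_carrier)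
    have "\<alpha> a \<in> carrier (model e)" using hom a by (auto simp: hom_def)
    moreover have "\<alpha> a \<otimes>\<^bsub>model e\<^esub> g = g \<otimes>\<^bsub>model e\<^esub> a"
      using a unfolding \<alpha>_def t_def ijk g_def
      by (cases j; cases k; simp add: model_mult model_act_def model_carrier; presburger)
    ultimately have "a = cj g (\<alpha> a)" using g a by (metis cj_eq_iff)
    then show ?thesis
      using g by (auto simp: conjugate_in_def cj_def)
  qed
  ultimately have "\<alpha> \<in> Aut_c (model e)" by (simp add: Aut_c_def)
  moreover have "\<alpha> \<notin> Inn (model e)"
  proof
    assume "\<alpha> \<in> Inn (model e)"
    then obtain g where g: "g \<in> carrier (model e)"
      and \<alpha>: "\<alpha> = (\<lambda>a\<in>carrier (model e). cj g a)"
      by (auto simp: Inn_def cj_def)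
    obtain i j k where ijk: "g = (i, j, k)" by (cases g)
    have *: "a \<otimes>\<^bsub>model e\<^esub> g = g \<otimes>\<^bsub>model e\<^esub> \<alpha> a" if "a \<in> carrier (model e)" for a
      using that g by (subst cj_eq_iff[symmetric]) (auto simp: \<alpha>)
    have 1: "(1, False, False) \<in> carrier (model e)" "(0, True, False) \<in> carrier (model e)"
      "(0, False, True) \<in> carrier (model e)"
      by (simp_all add: model_carrier)
    \<comment> \<open>Fixing y forces g into <y>. Then fixing x makes its exponent even, whereas the
      image of z makes it odd.\<close>
    have "(1 + i) mod 8 = (i + model_act j k) mod 8"
      using *[OF 1(1)] 1
      by (simp add: ijk \<alpha>_eq model_mult model_act_def t_def)
    then have "8 dvd (1 + i) - (i + model_act j k)" by (simp only: mod_eq_dvd_iff)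
    then have jk: "\<not> j \<and> \<not> k"
      by (cases j; cases k; simp add: model_act_def)
    have "(5 * i) mod 8 = i mod 8"
      using *[OF 1(2)] 1 by (simp add: ijk jk \<alpha>_eq model_mult model_act_def t_def)
    then have "8 dvd 5 * i - i" by (simp only: mod_eq_dvd_iff)
    moreover have "(- i) mod 8 = (i + 6) mod 8"
      using *[OF 1(3)] 1 by (simp add: ijk jk \<alpha>_eq model_mult model_act_def t_def)
    then have "8 dvd - i - (i + 6)" by (simp only: mod_eq_dvd_iff)
    ultimately show False by presburger
  qed
  ultimately show ?thesis by blast
qed

text \<open>A class preserving map of H is pulled back to G, where it is conjugation by some g, so
  it is itself conjugation by the image of g. The contrapositive carries the exotic automorphism
  from the model to the presented groups.\<close>

lemma Aut_c_eq_Inn_iso: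
  assumes "group G" "group H" "G \<cong> H" and eq: "Aut_c G = Inn G"
  shows "Aut_c H = Inn H"
proof
  interpret G: group G by fact
  interpret H: group H by fact
  show "Inn H \<subseteq> Aut_c H" by (rule H.Inn_subset_Aut_c)
  obtain f where f: "f \<in> iso G H" using assms(3) by (auto simp: is_iso_def)
  define f' where "f' = inv_into (carrier G) f"
  have f': "f' \<in> iso H G" unfolding f'_def using f by (rule G.iso_set_sym)
  interpret f: group_hom G H f
    using f by unfold_locales (auto simp: iso_def)
  interpret f': group_hom H G f'
    using f' by unfold_locales (auto simp: iso_def)
  have ff' [simp]: "f (f' b) = b" if "b \<in> carrier H" for b
    using f that unfolding f'_def iso_def bij_betw_def by (auto intro: f_inv_into_f)
  show "Aut_c H \<subseteq> Inn H"
  proof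
    fix \<beta> assume \<beta>: "\<beta> \<in> Aut_c H"
    then have hom: "\<beta> \<in> hom H H" and bij: "bij_betw \<beta> (carrier H) (carrier H)"
      and ext: "\<beta> \<in> extensional (carrier H)"
      by (auto simp: Aut_c_def auto_def Bij_def)
    have [simp]: "\<beta> b \<in> carrier H" if "b \<in> carrier H" for b
      using hom that by (auto simp: hom_def)
    define \<alpha> where "\<alpha> = (\<lambda>a\<in>carrier G. f' (\<beta> (f a)))"
    have "bij_betw (f' \<circ> (\<beta> \<circ> f)) (carrier G) (carrier G)"
      using f f' bij by (auto simp: iso_def intro: bij_betw_trans)
    then have "bij_betw \<alpha> (carrier G) (carrier G)"
      by (subst bij_betw_cong[of _ _ "f' \<circ> (\<beta> \<circ> f)"]) (auto simp: \<alpha>_def)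
    moreover have "\<alpha> \<in> hom G G"
      using hom by (auto simp: hom_def \<alpha>_def)
    moreover have "conjugate_in G (\<alpha> a) a" if a: "a \<in> carrier G" for a
    proof -
      obtain h where h: "h \<in> carrier H" "f a = inv\<^bsub>H\<^esub> h \<otimes>\<^bsub>H\<^esub> \<beta> (f a) \<otimes>\<^bsub>H\<^esub> h"
        using \<beta> f.hom_closed[OF a] unfolding Aut_c_def conjugate_in_def by blast
      have "a = f' (f a)" using f a unfolding f'_def iso_def bij_betw_def by simp
      also have "\<dots> = inv\<^bsub>G\<^esub> (f' h) \<otimes>\<^bsub>G\<^esub> \<alpha> a \<otimes>\<^bsub>G\<^esub> f' h"
        using h(1) a by (subst h(2)) (simp add: \<alpha>_def)
      finally show ?thesis using h by (auto simp: conjugate_in_def)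
    qed
    ultimately have "\<alpha> \<in> Inn G"
      unfolding eq[symmetric] by (auto simp: Aut_c_def auto_def Bij_def \<alpha>_def)
    then obtain g where g: "g \<in> carrier G"
      "\<alpha> = (\<lambda>a\<in>carrier G. inv\<^bsub>G\<^esub> g \<otimes>\<^bsub>G\<^esub> a \<otimes>\<^bsub>G\<^esub> g)"
      by (auto simp: Inn_def)
    have "\<beta> b = inv\<^bsub>H\<^esub> (f g) \<otimes>\<^bsub>H\<^esub> b \<otimes>\<^bsub>H\<^esub> f g" if b: "b \<in> carrier H" for b
    proof -
      have "\<beta> b = f (\<alpha> (f' b))" using b by (simp add: \<alpha>_def)
      also have "\<dots> = inv\<^bsub>H\<^esub> (f g) \<otimes>\<^bsub>H\<^esub> b \<otimes>\<^bsub>H\<^esub> f g"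
        using b g by simp
      finally show ?thesis .
    qed
    then have "\<beta> = (\<lambda>b\<in>carrier H. inv\<^bsub>H\<^esub> (f g) \<otimes>\<^bsub>H\<^esub> b \<otimes>\<^bsub>H\<^esub> f g)"
      using ext by (auto intro: extensionalityI)
    then show "\<beta> \<in> Inn H" using g by (auto simp: Inn_def)
  qed
qed

section \<open>Presentations\<close>

lemma free_group_subset:
  assumes "subgroup S free_group" "\<And>a. free_gen a \<in> S"
  shows "carrier free_group \<subseteq> S"
proof -
  interpret S: subgroup S free_group by fact
  interpret F: group free_group by (rule group_free_group)
  have gen: "word_class [(a, b)] \<in> S" for a b
  proof (cases b)
    case True then show ?thesis using assms(2)[of a] by (simp add: free_gen_def)
  next
    case False
    have "word_class [(a, False)] = inv\<^bsub>free_group\<^esub> (free_gen a)"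
    proof (rule F.inv_equality[symmetric])
      show "word_class [(a, False)] \<otimes>\<^bsub>free_group\<^esub> free_gen a = \<one>\<^bsub>free_group\<^esub>"
        using free_eq.cancel[of "[]" a False "[]"]
        by (simp add: free_gen_def free_group_mult free_group_one word_class_eq_iff)
    qed (auto simp: free_gen_def free_group_carrier)
    then show ?thesis using False assms(2)[of a] by simp
  qed
  have "word_class w \<in> S" for w
  proof (induction w)
    case Nil then show ?case using S.one_closed by (simp add: free_group_one)
  next
    case (Cons l w)
    then have "word_class [l] \<otimes>\<^bsub>free_group\<^esub> word_class w \<in> S"
      using gen[of "fst l" "snd l"] by (intro S.m_closed) simp_all
    then show ?case by (simp add: free_group_mult)
  qed
  then show ?thesis by (auto simp: free_group_carrier)
qed

lemma free_gen_closed [simp]: "free_gen a \<in> carrier free_group"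
  by (simp add: free_gen_def free_group_carrier)

text \<open>Words are evaluated letter by letter. Deleting a letter next to its inverse keeps the
  value, so the value descends to classes.\<close>

lemma (in group) free_group_universal:
  fixes g :: "'g \<Rightarrow> 'a"
  assumes g [simp]: "\<And>a. g a \<in> carrier G"
  obtains h where "h \<in> hom free_group G" "\<And>a. h (free_gen a) = g a"
proof -
  \<comment> \<open>The start value of the fold stays a parameter, so evaluating a concatenation is
    composing evaluations.\<close>
  define ev where "ev = foldr (\<lambda>(a, b) v. (if b then g a else inv g a) \<otimes> v)"
  have ev_Cons: "ev (l # w) v = (if snd l then g (fst l) else inv g (fst l)) \<otimes> ev w v" for l w v
    by (simp add: ev_def split_beta)
  have ev_Nil: "ev [] v = v" for v by (simp add: ev_def)
  have closed [simp]: "ev w v \<in> carrier G" if "v \<in> carrier G" for w v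
    using that by (induction w) (simp_all add: ev_Cons ev_Nil)
  have app: "ev (u @ v) w = ev u (ev v w)" for u v w
    by (simp add: ev_def)
  have ev_mult: "ev u v = ev u \<one> \<otimes> v" if "v \<in> carrier G" for u v
    using that by (induction u) (auto simp: ev_Cons ev_Nil m_assoc)
  have cong: "free_eq u v \<Longrightarrow> ev u \<one> = ev v \<one>" for u v
  proof (induction rule: free_eq.induct)
    case (cancel u a b v)
    show ?case by (simp add: app ev_Cons)
  qed simp_all
  define h where "h A = ev (SOME w. A = word_class w) \<one>" for A
  have h: "h (word_class w) = ev w \<one>" for w
  proof -
    have "word_class w = word_class (SOME w'. word_class w = word_class w')"
      by (rule someI) (rule HOL.refl)
    then show ?thesis unfolding h_def word_class_eq_iff by (metis cong)
  qed
  show thesis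
  proof
    show "h \<in> hom free_group G"
    proof (rule homI)
      fix A B :: "'g word set" assume "A \<in> carrier free_group" "B \<in> carrier free_group"
      then obtain u v where "A = word_class u" "B = word_class v"
        by (auto simp: free_group_carrier)
      then show "h (A \<otimes>\<^bsub>free_group\<^esub> B) = h A \<otimes> h B"
        by (simp add: free_group_mult h app ev_mult[of "ev v \<one>" u])
    qed (auto simp: free_group_carrier h)
    show "h (free_gen a) = g a" for a
      by (simp add: free_gen_def h ev_Cons ev_Nil)
  qed
qed

text \<open>The last property stands in for the induced map on the quotient: the kernel of p lies in
  the kernel of every h that kills the relators. With it, injectivity of a map into the presented
  group can be tested on words.\<close>

lemma presented_group_hom:
  assumes R: "R \<subseteq> carrier free_group"
  obtains p where "p \<in> hom free_group (presented_group R)"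
    "p ` carrier free_group = carrier (presented_group R)"
    "\<And>r. r \<in> R \<Longrightarrow> p r = \<one>\<^bsub>presented_group R\<^esub>"
    "\<And>w H h. group H \<Longrightarrow> h \<in> hom free_group H \<Longrightarrow> (\<And>r. r \<in> R \<Longrightarrow> h r = \<one>\<^bsub>H\<^esub>) \<Longrightarrow>
       w \<in> carrier free_group \<Longrightarrow> p w = \<one>\<^bsub>presented_group R\<^esub> \<Longrightarrow> h w = \<one>\<^bsub>H\<^esub>"
proof -
  interpret F: group "free_group :: 'a word set monoid" by (rule group_free_group)
  define N where "N = normal_closure free_group R"
  interpret N: normal N free_group
    unfolding N_def using R by (rule F.normal_closure_normal)
  have P: "presented_group R = free_group Mod N" by (simp add: presented_group_def N_def)
  define p where "p w = N #>\<^bsub>free_group\<^esub> w" for w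
  show thesis
  proof
    show "p \<in> hom free_group (presented_group R)"
      unfolding P p_def by (rule N.r_coset_hom_Mod)
    show "p ` carrier free_group = carrier (presented_group R)"
      unfolding P p_def by (rule carrier_FactGroup[symmetric])
    fix r assume r: "r \<in> R"
    have "r = \<one>\<^bsub>free_group\<^esub> \<otimes>\<^bsub>free_group\<^esub> r \<otimes>\<^bsub>free_group\<^esub> inv\<^bsub>free_group\<^esub> \<one>\<^bsub>free_group\<^esub>"
      using r R by auto
    then have "r \<in> N"
      unfolding N_def normal_closure_def using r by (blast intro: generate.incl F.one_closed)
    then show "p r = \<one>\<^bsub>presented_group R\<^esub>"
      unfolding p_def P by (simp add: N.rcos_const)
  next
    fix w H h
    assume "group H" and h: "h \<in> hom free_group H" and kill: "\<And>r. r \<in> R \<Longrightarrow> h r = \<one>\<^bsub>H\<^esub>"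
      and w: "w \<in> carrier free_group" "p w = \<one>\<^bsub>presented_group R\<^esub>"
    interpret h: group_hom free_group H h
      using \<open>group H\<close> h by (simp add: group_hom_def group_hom_axioms_def F.group_axioms)
    have "N \<subseteq> kernel free_group H h"
      unfolding N_def normal_closure_def
      by (rule F.generate_subgroup_incl[OF _ h.subgroup_kernel])
         (use R kill in \<open>auto simp: kernel_def subset_iff\<close>)
    moreover have "w \<in> N"
      using w F.rcos_self[OF w(1) N.subgroup_axioms] unfolding p_def P by simp
    ultimately show "h w = \<one>\<^bsub>H\<^esub>" by (auto simp: kernel_def)
  qed
qed

section \<open>Both presentations at once, and their identification with the model\<close>

definition phi6_relators :: "bool \<Rightarrow> gen word set set" where
  "phi6_relators e =
    (let F = free_group; x = free_gen gen_x; y = free_gen gen_y; z = free_gen gen_z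
     in {x [^]\<^bsub>F\<^esub> (2::nat),
        (if e then z [^]\<^bsub>F\<^esub> (2::nat) \<otimes>\<^bsub>F\<^esub> inv\<^bsub>F\<^esub> (y [^]\<^bsub>F\<^esub> (4::nat)) else z [^]\<^bsub>F\<^esub> (2::nat)),
        commutator F y x \<otimes>\<^bsub>F\<^esub> y [^]\<^bsub>F\<^esub> (4::nat),
        commutator F y z \<otimes>\<^bsub>F\<^esub> y [^]\<^bsub>F\<^esub> (2::nat),
        commutator F x z})"

lemma G44_eq: "G44 = presented_group (phi6_relators False)"
  and G45_eq: "G45 = presented_group (phi6_relators True)"
  by (simp_all add: G44_def G45_def phi6_relators_def Let_def)

lemma phi6_relators_closed: "phi6_relators e \<subseteq> carrier free_group"
proof -
  interpret F: group "free_group :: gen word set monoid" by (rule group_free_group)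
  show ?thesis by (auto simp: phi6_relators_def Let_def commutator_def)
qed

lemma phi6_gens_if_relators:
  assumes "group H" and h: "h \<in> hom free_group H"
    and kill: "\<And>r. r \<in> phi6_relators e \<Longrightarrow> h r = \<one>\<^bsub>H\<^esub>"
  shows "phi6_gens H e (h (free_gen gen_x)) (h (free_gen gen_y)) (h (free_gen gen_z))"
proof -
  interpret F: group "free_group :: gen word set monoid" by (rule group_free_group)
  interpret H: group H by fact
  interpret h: group_hom free_group H h
    using h by unfold_locales
  define x y z where xyz: "x = h (free_gen gen_x)" "y = h (free_gen gen_y)" "z = h (free_gen gen_z)"
  have c [simp]: "x \<in> carrier H" "y \<in> carrier H" "z \<in> carrier H" by (simp_all add: xyz)
  have comm: "h (commutator free_group a b) = inv\<^bsub>H\<^esub> (h a) \<otimes>\<^bsub>H\<^esub> H.cj (h b) (h a)"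
    if "a \<in> carrier free_group" "b \<in> carrier free_group" for a b
    using that by (simp add: commutator_def H.cj_def H.m_assoc)
  note k = kill[unfolded phi6_relators_def Let_def]
  have 1: "x [^]\<^bsub>H\<^esub> (2::nat) = \<one>\<^bsub>H\<^esub>"
    using k[of "free_gen gen_x [^]\<^bsub>free_group\<^esub> (2::nat)"] by (simp add: h.hom_nat_pow xyz)
  have 2: "z [^]\<^bsub>H\<^esub> (2::nat) = (if e then y [^]\<^bsub>H\<^esub> (4::nat) else \<one>\<^bsub>H\<^esub>)"
    using k[of "if e then free_gen gen_z [^]\<^bsub>free_group\<^esub> (2::nat) \<otimes>\<^bsub>free_group\<^esub> inv\<^bsub>free_group\<^esub> (free_gen gen_y [^]\<^bsub>free_group\<^esub> (4::nat)) else free_gen gen_z [^]\<^bsub>free_group\<^esub> (2::nat)"]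
    by (auto simp: h.hom_nat_pow xyz H.inv_solve_right' split: if_splits)
  have 3: "inv\<^bsub>H\<^esub> y \<otimes>\<^bsub>H\<^esub> H.cj x y \<otimes>\<^bsub>H\<^esub> y [^]\<^bsub>H\<^esub> (4::nat) = \<one>\<^bsub>H\<^esub>"
    using k[of "commutator free_group (free_gen gen_y) (free_gen gen_x) \<otimes>\<^bsub>free_group\<^esub> free_gen gen_y [^]\<^bsub>free_group\<^esub> (4::nat)"]
    by (simp add: h.hom_nat_pow xyz comm F.commutator_closed)
  have 4: "inv\<^bsub>H\<^esub> y \<otimes>\<^bsub>H\<^esub> H.cj z y \<otimes>\<^bsub>H\<^esub> y [^]\<^bsub>H\<^esub> (2::nat) = \<one>\<^bsub>H\<^esub>"
    using k[of "commutator free_group (free_gen gen_y) (free_gen gen_z) \<otimes>\<^bsub>free_group\<^esub> free_gen gen_y [^]\<^bsub>free_group\<^esub> (2::nat)"]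
    by (simp add: h.hom_nat_pow xyz comm F.commutator_closed)
  have 5: "inv\<^bsub>H\<^esub> x \<otimes>\<^bsub>H\<^esub> H.cj z x = \<one>\<^bsub>H\<^esub>"
    using k[of "commutator free_group (free_gen gen_x) (free_gen gen_z)"]
    by (simp add: comm xyz)
  have int4: "y [^]\<^bsub>H\<^esub> (4::nat) = y [^]\<^bsub>H\<^esub> (4::int)" and int2: "y [^]\<^bsub>H\<^esub> (2::nat) = y [^]\<^bsub>H\<^esub> (2::int)"
    using int_pow_int[of H y 4] int_pow_int[of H y 2] by simp_all
  \<comment> \<open>A relator [y, g] y^m reads inv y times y^g times y^m, so y^g is y^(1-m): the
    exponents -3 and -1 come from m = 4 and m = 2.\<close>
  have solve: "w = y [^]\<^bsub>H\<^esub> (1 - m :: int)"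
    if "inv\<^bsub>H\<^esub> y \<otimes>\<^bsub>H\<^esub> w \<otimes>\<^bsub>H\<^esub> y [^]\<^bsub>H\<^esub> m = \<one>\<^bsub>H\<^esub>" "w \<in> carrier H" for w and m :: int
  proof -
    have "inv\<^bsub>H\<^esub> y \<otimes>\<^bsub>H\<^esub> w = inv\<^bsub>H\<^esub> (y [^]\<^bsub>H\<^esub> m)"
      using that by (intro H.inv_equality[symmetric]) auto
    then have "w = y \<otimes>\<^bsub>H\<^esub> inv\<^bsub>H\<^esub> (y [^]\<^bsub>H\<^esub> m)"
      using that by (simp add: H.inv_solve_left')
    then show ?thesis by (simp add: H.int_pow_diff)
  qed
  have "phi6_gens H e x y z"
  proof (rule H.phi6_gensI)
    show "x \<otimes>\<^bsub>H\<^esub> x = \<one>\<^bsub>H\<^esub>" using 1 by (simp add: numeral_2_eq_2)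
    show "z \<otimes>\<^bsub>H\<^esub> z = (if e then y [^]\<^bsub>H\<^esub> (4::int) else \<one>\<^bsub>H\<^esub>)"
      using 2 by (simp add: int4 numeral_2_eq_2)
    show "H.cj x y = y [^]\<^bsub>H\<^esub> (- 3 :: int)"
      using solve[OF 3[unfolded int4]] by simp
    show "H.cj z y = y [^]\<^bsub>H\<^esub> (- 1 :: int)"
      using solve[OF 4[unfolded int2]] by simp
    have "H.cj z x = x" using 5 by (simp add: H.inv_solve_left')
    then show "x \<otimes>\<^bsub>H\<^esub> z = z \<otimes>\<^bsub>H\<^esub> x" by (simp add: H.cj_eq_iff)
  qed simp_all
  then show ?thesis by (simp add: xyz)
qed

context phi6_gens
begin

lemma relators_vanish:
  assumes h: "h \<in> hom free_group G"
    and xyz: "h (free_gen gen_x) = x" "h (free_gen gen_y) = y" "h (free_gen gen_z) = z"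
    and r: "r \<in> phi6_relators e"
  shows "h r = \<one>"
proof -
  interpret F: group "free_group :: gen word set monoid" by (rule group_free_group)
  interpret h: group_hom free_group G h
    using h by unfold_locales
  have comm: "h (commutator free_group a b) = inv (h a) \<otimes> cj (h b) (h a)"
    if "a \<in> carrier free_group" "b \<in> carrier free_group" for a b
    using that by (simp add: commutator_def cj_def m_assoc)
  have int4: "y [^] (4::nat) = y [^] (4::int)" and int2: "y [^] (2::nat) = y [^] (2::int)"
    using int_pow_int[of G y 4] int_pow_int[of G y 2] by simp_all
  \<comment> \<open>The locale lets x act from the left, \<open>cj\<close> from the right. The
    exponents agree because 25 is 1 modulo 8.\<close>
  have x5: "x \<otimes> y [^] (5::int) = y \<otimes> x"
    using commute_pow[OF _ xy, of 5] y_pow_eqI[of 25 1] by simp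
  have "cj x y = y [^] (5::int)" by (simp add: cj_eq_iff x5)
  moreover have "z \<otimes> y [^] (- 1 :: int) = y \<otimes> z"
    using commute_pow[OF _ zy, of "- 1"] by simp
  then have "cj z y = y [^] (- 1 :: int)" by (simp add: cj_eq_iff)
  moreover have "cj z x = x" by (simp add: cj_eq_iff xz)
  moreover have "y [^] (- 1 :: int) \<otimes> y [^] (5::int) \<otimes> y [^] (4::int) = \<one>"
    by (simp add: y8 flip: int_pow_mult)
  moreover have "y [^] (- 1 :: int) \<otimes> y [^] (- 1::int) \<otimes> (y \<otimes> y) = \<one>"
    by (simp add: int_pow_neg m_assoc)
  moreover have "inv y = y [^] (- 1 :: int)" by (simp add: int_pow_neg)
  ultimately show ?thesis
    using r by (auto simp: phi6_relators_def Let_def h.hom_nat_pow xyz comm int4 int2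
        numeral_2_eq_2 xx zz xz split: if_splits)
qed

end

lemma model_pow: "(1, False, False) [^]\<^bsub>model e\<^esub> (i::int) = (i mod 8, False, False)"
proof -
  interpret group "model e" by (rule group_model)
  let ?y = "(1, False, False)"
  have y: "?y \<in> carrier (model e)" by (simp add: model_carrier)
  have nat: "?y [^]\<^bsub>model e\<^esub> n = (int n mod 8, False, False)" for n :: nat
    by (induction n) (simp_all add: model_one model_mult model_act_def mod_simps add.commute)
  show ?thesis
  proof (cases i rule: int_cases2)
    case (nonneg n)
    then show ?thesis by (simp add: int_pow_int nat)
  next
    case (nonpos n)
    have "inv\<^bsub>model e\<^esub> (int n mod 8, False, False) = ((- int n) mod 8, False, False)"
      by (rule inv_equality) (simp_all add: model_carrier model_mult model_one model_act_def mod_simps)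
    then show ?thesis using y by (simp add: nonpos int_pow_neg_int nat)
  qed
qed

lemma model_gens:
  "phi6_gens (model e) e (0, True, False) (1, False, False) (0, False, True)"
  by (intro phi6_gens.intro phi6_gens_axioms.intro group_model)
    (simp_all add: model_pow model_mult model_carrier model_act_def model_one)

lemma model_nf:
  "a \<in> carrier (model e) \<Longrightarrow>
    phi6_gens.nf (model e) (0, True, False) (1, False, False) (0, False, True) a = a"
  unfolding phi6_gens.nf_def[OF model_gens] model_pow
  by (cases a) (auto simp: model_mult model_carrier model_act_def model_one)

text \<open>The image of \<open>PG.nf\<close> is a subgroup containing the generators, hence
  everything. Injectivity is obtained without computing the order of the presented group: a normal
  form that is trivial there lifts to a word w, which the homomorphism \<open>h\<close> to the model
  must also kill, but \<open>h w\<close> is the triple \<open>a\<close> itself.\<close>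

lemma model_iso_presented: "model e \<cong> presented_group (phi6_relators e)"
proof -
  let ?F = "free_group :: gen word set monoid" and ?P = "presented_group (phi6_relators e)"
  let ?x = "free_gen gen_x" and ?y = "free_gen gen_y" and ?z = "free_gen gen_z"
  interpret F: group ?F by (rule group_free_group)
  interpret P: group ?P by (rule group_presented_group) (rule phi6_relators_closed)
  obtain p where p: "p \<in> hom ?F ?P" and surj: "p ` carrier ?F = carrier ?P"
    and p_rel: "\<And>r. r \<in> phi6_relators e \<Longrightarrow> p r = \<one>\<^bsub>?P\<^esub>"
    and univ: "\<And>w H h. group (H :: (int \<times> bool \<times> bool) monoid) \<Longrightarrow> h \<in> hom ?F H \<Longrightarrow>
       (\<And>r. r \<in> phi6_relators e \<Longrightarrow> h r = \<one>\<^bsub>H\<^esub>) \<Longrightarrow> w \<in> carrier ?F \<Longrightarrow>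
       p w = \<one>\<^bsub>?P\<^esub> \<Longrightarrow> h w = \<one>\<^bsub>H\<^esub>"
    using presented_group_hom[OF phi6_relators_closed] by blast
  interpret p: group_hom ?F ?P p using p by unfold_locales
  interpret M: phi6_gens "model e" e "(0, True, False)" "(1, False, False)" "(0, False, True)"
    by (rule model_gens)
  interpret PG: phi6_gens ?P e "p ?x" "p ?y" "p ?z"
    by (rule phi6_gens_if_relators[OF P.group_axioms p p_rel])
  interpret nf: group_hom "model e" ?P PG.nf using PG.nf_hom by unfold_locales
  define g :: "gen \<Rightarrow> int \<times> bool \<times> bool" where "g = (\<lambda>a. case a of
      gen_x \<Rightarrow> (0, True, False) | gen_y \<Rightarrow> (1, False, False) | gen_z \<Rightarrow> (0, False, True))"
  have "g a \<in> carrier (model e)" for a by (cases a) (simp_all add: g_def model_carrier)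
  then obtain h where h: "h \<in> hom ?F (model e)" and hg: "\<And>a. h (free_gen a) = g a"
    using M.free_group_universal[of g] by blast
  interpret h: group_hom ?F "model e" h using h by unfold_locales
  have "a = \<one>\<^bsub>model e\<^esub>" if a: "a \<in> carrier (model e)" and "PG.nf a = \<one>\<^bsub>?P\<^esub>" for a
  proof -
    obtain i j k where ijk: "a = (i, j, k)" by (cases a)
    define w where "w = ?y [^]\<^bsub>?F\<^esub> i \<otimes>\<^bsub>?F\<^esub> ((if j then ?x else \<one>\<^bsub>?F\<^esub>) \<otimes>\<^bsub>?F\<^esub> (if k then ?z else \<one>\<^bsub>?F\<^esub>))"
    have w: "w \<in> carrier ?F" by (simp add: w_def)
    have "p w = PG.nf a"
      unfolding PG.nf_def w_def ijk by (simp add: p.hom_int_pow)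
    then have "p w = \<one>\<^bsub>?P\<^esub>" using that by simp
    then have "h w = \<one>\<^bsub>model e\<^esub>"
      by (intro univ[OF group_model h _ w] M.relators_vanish[OF h]) (simp_all add: hg g_def)
    also have "h w = M.nf a"
      unfolding M.nf_def w_def ijk by (simp add: h.hom_int_pow hg g_def)
    finally show ?thesis using a by (simp add: model_nf)
  qed
  then have "inj_on PG.nf (carrier (model e))"
    by (subst nf.inj_iff_trivial_ker) (auto simp: kernel_def)
  moreover have "PG.nf ` carrier (model e) = carrier ?P"
  proof
    show "PG.nf ` carrier (model e) \<subseteq> carrier ?P" by auto
    define S where "S = {w \<in> carrier ?F. p w \<in> PG.nf ` carrier (model e)}"
    have sub: "subgroup (PG.nf ` carrier (model e)) ?P"
      by (rule nf.img_is_subgroup)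
    have "subgroup S ?F"
      by (rule F.subgroupI)
        (auto simp: S_def subgroup.m_closed[OF sub] subgroup.m_inv_closed[OF sub]
          intro!: exI[of _ "\<one>\<^bsub>?F\<^esub>"] subgroup.one_closed[OF sub])
    moreover have "free_gen a \<in> S" for a
    proof -
      have "p ?y = PG.nf (1, False, False)" "p ?x = PG.nf (0, True, False)"
        "p ?z = PG.nf (0, False, True)"
        by (simp_all add: PG.nf_def)
      then show ?thesis by (cases a) (auto simp: S_def model_carrier intro!: imageI)
    qed
    ultimately have "carrier ?F \<subseteq> S" by (rule free_group_subset)
    then show "carrier ?P \<subseteq> PG.nf ` carrier (model e)"
      unfolding surj[symmetric] by (auto simp: S_def)
  qed
  ultimately have "PG.nf \<in> iso (model e) ?P"
    using PG.nf_hom by (simp add: iso_def bij_betw_def)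
  then show ?thesis by (auto simp: is_iso_def)
qed

lemma G44_iso: "model False \<cong> G44" and G45_iso: "model True \<cong> G45"
  unfolding G44_eq G45_eq by (rule model_iso_presented)+

lemma group_G44: "group G44" and group_G45: "group G45"
  unfolding G44_eq G45_eq by (intro group_presented_group phi6_relators_closed)+

lemma G44_exotic: "Aut_c G44 \<noteq> Inn G44" and G45_exotic: "Aut_c G45 \<noteq> Inn G45"
  using Aut_c_eq_Inn_iso[OF group_G44 group_model group.iso_sym[OF group_model G44_iso]]
    Aut_c_eq_Inn_iso[OF group_G45 group_model group.iso_sym[OF group_model G45_iso]]
    model_exotic by blast+

section \<open>Recognition from an element of order 8\<close>

context group
begin

lemma int_pow_order8:
  assumes y: "y \<in> carrier G" and 4: "y [^] (4::int) \<noteq> \<one>" and 8: "y [^] (8::int) = \<one>"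
  shows "y [^] (i::int) = y [^] (j::int) \<longleftrightarrow> 8 dvd i - j"
proof -
  have "int (ord y) dvd 8" "\<not> int (ord y) dvd 4"
    using 8 4 y int_pow_eq_id by blast+
  then have "ord y dvd 8" "\<not> ord y dvd 4" by (metis of_nat_numeral of_nat_dvd_iff)+
  then have "ord y = 8"
    using dvd_imp_le[of "ord y" 8] by (auto simp: le_Suc_eq numeral_eq_Suc dvd_def; presburger)
  then show ?thesis using y int_pow_eq[of y i j] by (simp add: dvd_diff_commute)
qed


text \<open>The exponents 1, 5, -1, -5 are distinct modulo 8, so the action on y separates cosets of
  <y>, and counting 8 * 4 = 32 makes every element some y^i x^j s^k. Hence <y> is its own
  centralizer. The squares and the commutator of x and s act trivially on y, so they are powers of y
  and can be corrected.\<close>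

lemma iso_model_if_order8:
  assumes ord: "order G = 32"
    and c [simp]: "y \<in> carrier G" "x \<in> carrier G" "s \<in> carrier G"
    and y4: "y [^] (4::int) \<noteq> \<one>" and y8: "y [^] (8::int) = \<one>"
    and x: "cj x y = y [^] (5::int)" and s: "cj s y = y [^] (- 1::int)"
  shows "\<exists>e. model e \<cong> G"
proof -
  note pow_eq = int_pow_order8[OF c(1) y4 y8]
  have y_commute: "y [^] i \<otimes> y [^] j = y [^] j \<otimes> y [^] i" for i j :: int
    by (simp add: add.commute flip: int_pow_mult)
  have cj_y: "cj (y [^] i) (y [^] j) = y [^] j" for i j :: int
    by (simp add: cj_eq_iff y_commute)
  have finite: "finite (carrier G)"
    using ord by (simp add: order_def card_ge_0_finite)
  have sq1: "cj g (cj g y) = y [^] (m * m)" if "cj g y = y [^] m" "g \<in> carrier G" for g and m :: int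
    using that by (simp add: cj_int_pow int_pow_pow)
  \<comment> \<open>The arguments x and s are kept variable: bijectivity is applied to the given
    pair and again to the corrected pair \<open>x1\<close>, \<open>s1\<close>.\<close>
  define f where "f x s = (\<lambda>(i::int, j, k). y [^] i \<otimes> ((if j then x else \<one>) \<otimes> (if k then s else \<one>)))"
    for x s
  have cj_f: "cj (f x s (i, j, k)) y = y [^] model_act j k"
    if "cj x y = y [^] (5::int)" "cj s y = y [^] (- 1::int)" "x \<in> carrier G" "s \<in> carrier G" for i j k x s
    using that cj_y[of i 1] 
    by (cases j; cases k) (simp_all add: f_def cj_int_pow int_pow_pow model_act_def int_pow_neg int_pow_inv flip: cj_cj)
  have inj: "inj_on (f x s) (carrier (model e))"
    if "cj x y = y [^] (5::int)" "cj s y = y [^] (- 1::int)" "x \<in> carrier G" "s \<in> carrier G" for e x s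
  proof (rule inj_onI)
    fix a b assume ab: "a \<in> carrier (model e)" "b \<in> carrier (model e)" "f x s a = f x s b"
    obtain i j k where a: "a = (i, j, k)" by (cases a)
    obtain i' j' k' where b: "b = (i', j', k')" by (cases b)
    have "y [^] model_act j k = y [^] model_act j' k'"
      using ab(3) cj_f[OF that, of i j k] cj_f[OF that, of i' j' k'] by (simp add: a b)
    then have "8 dvd model_act j k - model_act j' k'" by (simp add: pow_eq)
    then have jk: "j' = j \<and> k' = k"
      by (cases j; cases k; cases j'; cases k'; simp add: model_act_def)
    then have "y [^] i = y [^] i'"
      using ab(3) that by (simp add: a b f_def)
    then have "8 dvd i - i'" by (simp add: pow_eq)
    then have "i = i'" using ab(1,2) by (simp add: a b model_carrier) presburger
    then show "a = b" using jk by (simp add: a b)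
  qed
  have bij: "bij_betw (f x s) (carrier (model e)) (carrier G)"
    if "cj x y = y [^] (5::int)" "cj s y = y [^] (- 1::int)" "x \<in> carrier G" "s \<in> carrier G" for e x s
    unfolding bij_betw_def
  proof (intro conjI inj[OF that])
    show "f x s ` carrier (model e) = carrier G"
    proof (rule card_subset_eq[OF finite])
      show "f x s ` carrier (model e) \<subseteq> carrier G" using that by (auto simp: f_def)
      show "card (f x s ` carrier (model e)) = card (carrier G)"
        using card_model[of e] ord by (simp add: card_image[OF inj[OF that]] order_def)
    qed
  qed
  have centralizer: "\<exists>i::int. g = y [^] i" if g: "g \<in> carrier G" "cj g y = y" for g
  proof -
    have "g \<in> f x s ` carrier (model True)"
      using bij[OF x s] g by (simp add: bij_betw_def)
    then obtain i j k where ijk: "g = f x s (i, j, k)" by auto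
    then have "y [^] model_act j k = y [^] (1::int)" using cj_f[OF x s, of i j k] g by simp
    then have "8 dvd model_act j k - 1" by (simp only: pow_eq)
    then have "\<not> j \<and> \<not> k" by (cases j; cases k; simp add: model_act_def)
    then show ?thesis by (auto simp: ijk f_def)
  qed
  have mult_sq: "(g \<otimes> y [^] j) \<otimes> (g \<otimes> y [^] j) = g \<otimes> g \<otimes> y [^] (m * j + j)"
    if "cj g y = y [^] m" "g \<in> carrier G" for g and m j :: int
  proof -
    have "y [^] j \<otimes> g = g \<otimes> cj g (y [^] j)"
      using that by (simp add: cj_def m_assoc)
    then have "(g \<otimes> y [^] j) \<otimes> (g \<otimes> y [^] j) = g \<otimes> (g \<otimes> y [^] (m * j)) \<otimes> y [^] j"
      using that by (simp add: m_assoc cj_int_pow int_pow_pow flip: m_assoc[of "y [^] j"])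
    then show ?thesis using that by (simp add: m_assoc int_pow_mult)
  qed
  have sq_comm: "cj g (g \<otimes> g) = g \<otimes> g" if "g \<in> carrier G" for g
    using that by (simp add: cj_eq_iff m_assoc)
  have "cj (x \<otimes> x) y = y [^] (1::int)"
    using sq1[OF x] pow_eq[of 25 1] by (simp flip: cj_cj)
  then obtain k :: int where k: "x \<otimes> x = y [^] k" using centralizer[of "x \<otimes> x"] by auto
  \<comment> \<open>x commutes with its own square, so 8 divides 4 k and k is even.\<close>
  then have "y [^] (5 * k) = y [^] k" using sq_comm[of x] by (simp add: cj_int_pow x int_pow_pow)
  then have "8 dvd 5 * k - k" by (simp only: pow_eq)
  then have "\<exists>m. k = 2 * m" by presburger
  then obtain m where m: "k = 2 * m" ..
  \<comment> \<open>With k = 2 m the square of x y^m is y^(2 m + 5 m + m), which is trivial.\<close>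
  define x1 where "x1 = x \<otimes> y [^] m"
  have x1c [simp]: "x1 \<in> carrier G" by (simp add: x1_def)
  have x1x1: "x1 \<otimes> x1 = \<one>"
  proof -
    have "x1 \<otimes> x1 = y [^] (8 * m)"
      unfolding x1_def by (subst mult_sq[OF x]) (simp_all add: k m flip: int_pow_mult)
    also have "\<dots> = y [^] (0::int)" by (subst pow_eq) simp
    finally show ?thesis by simp
  qed
  have x1y: "cj x1 y = y [^] (5::int)"
    unfolding x1_def by (simp add: x cj_y flip: cj_cj)
  have "cj (s \<otimes> s) y = y [^] (1::int)"
    using sq1[OF s] by (simp flip: cj_cj)
  then obtain n :: int where n: "s \<otimes> s = y [^] n" using centralizer[of "s \<otimes> s"] by auto
  then have "y [^] (- n) = y [^] n" using sq_comm[of s] by (simp add: cj_int_pow s int_pow_pow)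
  then have "8 dvd - n - n" by (simp only: pow_eq)
  then have "8 dvd n \<or> 8 dvd n - 4" by presburger
  then have ss: "\<exists>e. s \<otimes> s = (if e then y [^] (4::int) else \<one>)"
    using pow_eq[of n 0] pow_eq[of n 4] by (auto simp: n intro: exI[of _ True] exI[of _ False])
  \<comment> \<open>Automorphisms of <y> commute, so this commutator centralizes y and is a power
    y^j. Then x1^2 = 1 forces y^(6 j) = 1, which leaves j = 0 or 4 modulo 8.\<close>
  define c where "c = inv x1 \<otimes> cj s x1"
  have c_closed: "c \<in> carrier G" by (simp add: c_def)
  have "cj c y = y [^] (1::int)"
  proof -
    have "cj x1 (y [^] (5::int)) = y [^] (1::int)"
      using pow_eq[of 25 1] by (simp add: cj_int_pow x1y int_pow_pow)
    then have "cj (inv x1) y = y [^] (5::int)" by (metis c(1) cj_inv(2) int_pow_1 int_pow_closed x1c)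
    moreover have "cj (inv s) y = y [^] (- 1::int)"
    proof -
      have "cj s (y [^] (- 1 :: int)) = y" by (simp add: cj_int_pow s int_pow_pow)
      then show ?thesis by (metis c(1,3) cj_inv(2) int_pow_closed)
    qed
    moreover have "cj c y = cj s (cj x1 (cj (inv s) (cj (inv x1) y)))"
      by (simp add: c_def cj_def m_assoc inv_mult_group)
    ultimately have "cj c y = y [^] (25::int)"
      by (simp add: cj_int_pow s x1y int_pow_pow)
    also have "\<dots> = y [^] (1::int)" by (subst pow_eq) simp
    finally show ?thesis .
  qed
  then obtain j :: int where "c = y [^] j" using centralizer[OF c_closed] by auto
  then have cj_s: "cj s x1 = x1 \<otimes> y [^] j" by (simp add: c_def inv_solve_left')
  have "\<one> = cj s (x1 \<otimes> x1)" by (simp add: x1x1)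
  also have "\<dots> = (x1 \<otimes> y [^] j) \<otimes> (x1 \<otimes> y [^] j)"
    by (simp only: cj_mult c x1c cj_s)
  also have "\<dots> = y [^] (6 * j)"
    by (simp add: mult_sq[OF x1y] x1x1)
  finally have "8 dvd 6 * j - 0" by (subst pow_eq[symmetric]) simp
  then have j: "8 dvd j \<or> 8 dvd j - 4" by presburger
  have "\<exists>s1\<in>carrier G. cj s1 y = y [^] (- 1::int) \<and> s1 \<otimes> s1 = s \<otimes> s \<and> cj s1 x1 = x1"
  proof (cases "8 dvd j")
    case True
    then have "y [^] j = y [^] (0::int)" by (subst pow_eq) simp
    then show ?thesis using s cj_s by (intro bexI[of _ s]) simp_all
  next
    case False
    then have "y [^] j = y [^] (4::int)" using j by (subst pow_eq) simp
    \<comment> \<open>Replacing s by s y removes the exponent 4: conjugation by y multiplies x1 by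
      y^-4, while s y has the same square as s and acts on y in the same way.\<close>
    then have xs: "cj s x1 = x1 \<otimes> y [^] (4::int)" using cj_s by simp
    have "y \<otimes> (x1 \<otimes> y [^] (- 5 :: int)) = x1 \<otimes> (cj x1 y \<otimes> y [^] (- 5 :: int))"
      by (simp add: cj_def m_assoc)
    also have "\<dots> = x1" by (simp add: x1y flip: int_pow_mult)
    finally have E: "y \<otimes> (x1 \<otimes> y [^] (- 5 :: int)) = x1" .
    have "y \<otimes> (x1 \<otimes> y [^] (- 5 :: int) \<otimes> y) = y \<otimes> (x1 \<otimes> y [^] (- 5 :: int)) \<otimes> y"
      by (simp add: m_assoc)
    then have "cj y x1 = x1 \<otimes> y [^] (- 5 :: int) \<otimes> y"
      by (simp add: cj_eq_iff E)
    also have "\<dots> = x1 \<otimes> (y [^] (- 5 :: int) \<otimes> y [^] (1::int))" by (simp add: m_assoc)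
    also have "\<dots> = x1 \<otimes> y [^] (- 4 :: int)" by (simp flip: int_pow_mult del: int_pow_1)
    finally have "cj y (x1 \<otimes> y [^] (4::int)) = x1 \<otimes> (y [^] (- 4 :: int) \<otimes> y [^] (4 :: int))"
      using cj_y[of 1 4] by (simp add: cj_mult m_assoc)
    also have "\<dots> = x1" by (simp flip: int_pow_mult)
    finally have "cj (s \<otimes> y) x1 = x1" by (simp add: xs flip: cj_cj)
    moreover have "s \<otimes> y \<otimes> (s \<otimes> y) = s \<otimes> s"
      using mult_sq[OF s, of 1] by simp
    moreover have "cj (s \<otimes> y) y = y [^] (- 1::int)"
      using s cj_y[of 1 "- 1"] by (simp flip: cj_cj)
    ultimately show ?thesis by (intro bexI[of _ "s \<otimes> y"]) simp_all
  qed
  then obtain s1 e where s1 [simp]: "s1 \<in> carrier G" and s1y: "cj s1 y = y [^] (- 1::int)"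
    and s1s1: "s1 \<otimes> s1 = (if e then y [^] (4::int) else \<one>)" and s1x: "cj s1 x1 = x1"
    using ss by metis
  have "y [^] (5::int) = y [^] (- 3::int)" by (subst pow_eq) simp
  then have "phi6_gens G e x1 y s1"
    using x1x1 s1s1 s1x x1y s1y by (intro phi6_gensI) (simp_all add: cj_eq_iff)
  then interpret P: phi6_gens G e x1 y s1 .
  have "P.nf = f x1 s1" by (simp add: P.nf_def f_def)
  then have "P.nf \<in> iso (model e) G"
    using P.nf_hom bij[OF x1y s1y] by (simp add: iso_def)
  then show ?thesis by (auto simp: is_iso_def)
qed

end

section \<open>Class preserving maps and a maximal subgroup with small center\<close>

context group
begin

text \<open>The conjugating element may vary with the point. The property survives composition with
  \<open>cj g\<close>, so f can be normalised by inner maps; \<open>inner_of_comp\<close> undoes the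
  normalisation.\<close>

definition class_hom :: "('a \<Rightarrow> 'a) \<Rightarrow> bool" where
  "class_hom f \<longleftrightarrow> f \<in> hom G G \<and> (\<forall>x\<in>carrier G. \<exists>g\<in>carrier G. f x = cj g x)"

definition inner :: "('a \<Rightarrow> 'a) \<Rightarrow> bool" where
  "inner f \<longleftrightarrow> (\<exists>g\<in>carrier G. \<forall>x\<in>carrier G. f x = cj g x)"

text \<open>Since 5 and -1 generate the units modulo 8, this says that conjugation induces every
  automorphism of a cyclic subgroup of order 8. It is the input of
  \<open>iso_model_if_order8\<close>.\<close>

definition order8_gens :: bool where
  "order8_gens \<longleftrightarrow> (\<exists>y\<in>carrier G. \<exists>x\<in>carrier G. \<exists>s\<in>carrier G.
     y [^] (4::int) \<noteq> \<one> \<and> y [^] (8::int) = \<one> \<and> cj x y = y [^] (5::int) \<and> cj s y = y [^] (- 1::int))"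

lemma class_hom_closed: "class_hom f \<Longrightarrow> x \<in> carrier G \<Longrightarrow> f x \<in> carrier G"
  by (auto simp: class_hom_def hom_def)

lemma class_hom_mult: "class_hom f \<Longrightarrow> x \<in> carrier G \<Longrightarrow> y \<in> carrier G \<Longrightarrow> f (x \<otimes> y) = f x \<otimes> f y"
  by (auto simp: class_hom_def hom_def)

lemma class_hom_inv: "class_hom f \<Longrightarrow> x \<in> carrier G \<Longrightarrow> f (inv x) = inv (f x)"
  using group_hom.hom_inv[of G G f x] by (auto simp: class_hom_def group_hom_def group_hom_axioms_def)

lemma class_hom_one: "class_hom f \<Longrightarrow> f \<one> = \<one>"
  using group_hom.hom_one[of G G f] by (auto simp: class_hom_def group_hom_def group_hom_axioms_def)

lemma class_hom_cj: "class_hom f \<Longrightarrow> x \<in> carrier G \<Longrightarrow> y \<in> carrier G \<Longrightarrow> f (cj x y) = cj (f x) (f y)"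
  by (simp add: cj_def class_hom_mult class_hom_inv)

lemma class_hom_comp:
  assumes f: "class_hom f" and g: "g \<in> carrier G"
  shows "class_hom (\<lambda>x. cj g (f x))"
  unfolding class_hom_def
proof (intro conjI ballI)
  show "(\<lambda>x. cj g (f x)) \<in> hom G G"
    using f g by (intro homI) (simp_all add: class_hom_closed class_hom_mult cj_mult)
  fix x assume x: "x \<in> carrier G"
  then obtain h where "h \<in> carrier G" "f x = cj h x" using f by (auto simp: class_hom_def)
  then show "\<exists>h\<in>carrier G. cj g (f x) = cj h x"
    using g x by (intro bexI[of _ "h \<otimes> g"]) (simp_all add: cj_cj)
qed

lemma inner_of_comp:
  assumes f: "class_hom f" and g: "g \<in> carrier G" and i: "inner (\<lambda>x. cj g (f x))"
  shows "inner f"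
proof -
  obtain h where h: "h \<in> carrier G" "\<forall>x\<in>carrier G. cj g (f x) = cj h x"
    using i by (auto simp: inner_def)
  have "f x = cj (h \<otimes> inv g) x" if "x \<in> carrier G" for x
  proof -
    have "f x = cj (inv g) (cj g (f x))" using f g that by (simp add: class_hom_closed)
    then show ?thesis using h g that by (simp add: cj_cj)
  qed
  then show ?thesis using h g by (auto simp: inner_def)
qed

text \<open>Here z = y^4, so x acts by the exponent 5 and s by 3 or 7. The exponent 7 is -1 already;
  3 is repaired by composing with x, since 15 is -1 modulo 8.\<close>

lemma order8_gensI:
  assumes c [simp]: "y \<in> carrier G" "x \<in> carrier G" "s \<in> carrier G" "z \<in> carrier G"
    and z: "z \<noteq> \<one>" "z \<otimes> z = \<one>" "\<And>g. g \<in> carrier G \<Longrightarrow> z \<otimes> g = g \<otimes> z"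
    and y: "(y \<otimes> y) \<otimes> (y \<otimes> y) = z" and x: "cj x y = y \<otimes> z"
    and s: "cj s y = y \<otimes> (y \<otimes> y) \<or> cj s y = y \<otimes> (y \<otimes> y) \<otimes> z"
  shows order8_gens
proof -
  have y2: "y \<otimes> y = y [^] (2::int)"
    using int_pow_mult[of y 1 1] by simp
  have y4: "z = y [^] (4::int)"
    unfolding y[symmetric] y2 by (simp flip: int_pow_mult)
  have y8: "y [^] (8::int) = \<one>"
    using z(2) unfolding y4 by (simp flip: int_pow_mult)
  have yk: "y \<otimes> y [^] (i::int) = y [^] (1 + i)" for i
    by (simp add: int_pow_mult)
  have x5: "cj x y = y [^] (5::int)" using x by (simp add: y4 yk)
  have "y [^] (7::int) \<otimes> y = y [^] (7 + 1::int)" by (subst int_pow_mult) simp_all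
  then have y7: "y [^] (7::int) = y [^] (- 1::int)"
    using y8 by (simp add: int_pow_neg inv_equality)
  have "\<exists>s\<in>carrier G. cj s y = y [^] (- 1::int)"
  proof (cases "cj s y = y \<otimes> (y \<otimes> y)")
    case True
    then have "cj s y = y [^] (3::int)" by (simp add: y2 yk)
    then have "cj (s \<otimes> x) y = y [^] (15::int)"
      by (simp add: cj_int_pow x5 int_pow_pow flip: cj_cj)
    also have "\<dots> = y [^] (8::int) \<otimes> y [^] (7::int)" by (simp flip: int_pow_mult)
    also have "\<dots> = y [^] (- 1::int)" by (simp add: y8 y7)
    finally show ?thesis by (intro bexI[of _ "s \<otimes> x"]) simp_all
  next
    case False
    then have "cj s y = y [^] (3::int) \<otimes> y [^] (4::int)" using s by (simp add: y2 yk flip: y4)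
    also have "\<dots> = y [^] (- 1::int)" unfolding y7[symmetric] by (simp flip: int_pow_mult)
    finally show ?thesis by (intro bexI[of _ s]) simp_all
  qed
  then show ?thesis
    unfolding order8_gens_def using y8 x5 z(1) y4 by (metis c(1,2))
qed

text \<open>C and t generate G: every x outside C is t times an element of C.\<close>

lemma inner_if_agrees:
  assumes f: "class_hom f" and C: "subgroup C G"
    and index2: "\<And>g h. g \<in> carrier G - C \<Longrightarrow> h \<in> carrier G - C \<Longrightarrow> g \<otimes> h \<in> C"
    and t: "t \<in> carrier G - C" and e: "e \<in> carrier G"
    and fC: "\<And>c. c \<in> C \<Longrightarrow> f c = cj e c" and ft: "f t = cj e t"
  shows "inner f"
  unfolding inner_def
proof (intro bexI[of _ e] ballI)
  fix x assume x: "x \<in> carrier G"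
  have tc: "t \<in> carrier G" using t by simp
  show "f x = cj e x"
  proof (cases "x \<in> C")
    case False
    have "inv t \<in> carrier G - C" using t subgroup.m_inv_closed[OF C, of "inv t"] by auto
    then have i: "inv t \<otimes> x \<in> C" using x False by (intro index2) auto
    then have "inv t \<otimes> x \<in> carrier G" using C by (rule subgroup.mem_carrier[rotated])
    then have "f (t \<otimes> (inv t \<otimes> x)) = cj e (t \<otimes> (inv t \<otimes> x))"
      using fC[OF i] by (simp only: class_hom_mult[OF f tc] cj_mult[OF e tc] ft)
    then show ?thesis using x tc by simp
  qed (rule fC)
qed (rule e)

lemma subgroup_cover:
  assumes S: "subgroup S G" and T: "subgroup T G" and C: "subgroup C G" and cov: "C \<subseteq> S \<union> T"
  shows "C \<subseteq> S \<or> C \<subseteq> T"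
proof (rule ccontr)
  assume "\<not> ?thesis"
  then obtain a b where ab: "a \<in> C" "a \<notin> S" "b \<in> C" "b \<notin> T" by auto
  then have "a \<in> T" "b \<in> S" using cov by auto
  have c [simp]: "a \<in> carrier G" "b \<in> carrier G" using ab C by (auto dest: subgroup.mem_carrier)
  have "a \<otimes> b \<in> C" using ab C by (simp add: subgroup.m_closed)
  then consider "a \<otimes> b \<in> S" | "a \<otimes> b \<in> T" using cov by auto
  then show False
  proof cases
    case 1
    then have "(a \<otimes> b) \<otimes> inv b \<in> S"
      by (rule subgroup.m_closed[OF S _ subgroup.m_inv_closed[OF S \<open>b \<in> S\<close>]])
    then show False using ab by (simp add: m_assoc)
  next
    case 2
    then have "inv a \<otimes> (a \<otimes> b) \<in> T"
      by (rule subgroup.m_closed[OF T subgroup.m_inv_closed[OF T \<open>a \<in> T\<close>]])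
    then show False using ab by simp
  qed
qed

end

text \<open>The case of a nonabelian centralizer C of u. The set {1, z, u, u z} is the centre of C,
  commutators of C lie in {1, z} by \<open>C_class\<close>, and by \<open>C_commute\<close> the
  centralizer in C of a noncentral c consists of the centre and its coset by c. Stating this
  elementwise keeps cardinalities out of the calculations.\<close>

locale small_center = group G for G (structure) +
  fixes C :: "'a set" and u z :: 'a
  assumes C: "subgroup C G"
    and C_normal: "\<And>g c. g \<in> carrier G \<Longrightarrow> c \<in> C \<Longrightarrow> cj g c \<in> C"
    and C_index2: "\<And>g h. g \<in> carrier G - C \<Longrightarrow> h \<in> carrier G - C \<Longrightarrow> g \<otimes> h \<in> C"
    and z_carrier [simp]: "z \<in> carrier G" and z_neq: "z \<noteq> \<one>" and zz: "z \<otimes> z = \<one>"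
    and z_central: "\<And>g. g \<in> carrier G \<Longrightarrow> z \<otimes> g = g \<otimes> z"
    and u_C [simp]: "u \<in> C" and u_neq: "u \<noteq> \<one>" "u \<noteq> z"
    and z_C [simp]: "z \<in> C"
    and u_central: "\<And>c. c \<in> C \<Longrightarrow> u \<otimes> c = c \<otimes> u"
    and C_center: "\<And>v. v \<in> C \<Longrightarrow> (\<And>c. c \<in> C \<Longrightarrow> v \<otimes> c = c \<otimes> v) \<Longrightarrow> v \<in> {\<one>, z, u, u \<otimes> z}"
    and C_class: "\<And>c d. c \<in> C \<Longrightarrow> d \<in> C \<Longrightarrow> cj d c = c \<or> cj d c = c \<otimes> z"
    and C_commute: "\<And>c d. c \<in> C \<Longrightarrow> d \<in> C \<Longrightarrow> c \<otimes> d = d \<otimes> c \<Longrightarrow> c \<notin> {\<one>, z, u, u \<otimes> z} \<Longrightarrow>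
      d \<in> {\<one>, z, u, u \<otimes> z} \<or> inv c \<otimes> d \<in> {\<one>, z, u, u \<otimes> z}"
    and u_class: "\<And>g. g \<in> carrier G - C \<Longrightarrow> cj g u = u \<otimes> z"
    and nonabelian: "\<exists>a\<in>C. \<exists>b\<in>C. a \<otimes> b \<noteq> b \<otimes> a"
begin

text \<open>The simplification rules for this function move factors z outwards and cancel them in
  pairs, so calculating up to z becomes rewriting.\<close>

definition tw :: "'a \<Rightarrow> 'a" where "tw a = a \<otimes> z"

abbreviation "V \<equiv> {\<one>, tw \<one>, u, tw u}"

lemma V_eq: "{\<one>, z, u, u \<otimes> z} = V"
  by (simp add: tw_def)

lemma C_carrier [simp]: "c \<in> C \<Longrightarrow> c \<in> carrier G"
  using C by (rule subgroup.mem_carrier)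

lemma C_mult [simp]: "c \<in> C \<Longrightarrow> d \<in> C \<Longrightarrow> c \<otimes> d \<in> C"
  using C by (rule subgroup.m_closed)

lemma C_inv [simp]: "c \<in> C \<Longrightarrow> inv c \<in> C"
  using C by (rule subgroup.m_inv_closed)

lemma C_one [simp]: "\<one> \<in> C"
  using C by (rule subgroup.one_closed)

lemma tw_C [simp]: "c \<in> C \<Longrightarrow> tw c \<in> C"
  by (simp add: tw_def)

lemma tw_closed [simp]: "a \<in> carrier G \<Longrightarrow> tw a \<in> carrier G"
  by (simp add: tw_def)

lemma tw_tw [simp]: "a \<in> carrier G \<Longrightarrow> tw (tw a) = a"
  by (simp add: tw_def m_assoc zz)

lemma tw_mult_right [simp]: "a \<in> carrier G \<Longrightarrow> b \<in> carrier G \<Longrightarrow> a \<otimes> tw b = tw (a \<otimes> b)"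
  by (simp add: tw_def m_assoc)

lemma tw_mult_left [simp]: "a \<in> carrier G \<Longrightarrow> b \<in> carrier G \<Longrightarrow> tw a \<otimes> b = tw (a \<otimes> b)"
  using z_central[of b] by (simp add: tw_def m_assoc)

lemma tw_neq [simp]: "a \<in> carrier G \<Longrightarrow> tw a \<noteq> a" "a \<in> carrier G \<Longrightarrow> a \<noteq> tw a"
  using z_neq by (auto simp: tw_def)

lemma tw_inj [simp]: "a \<in> carrier G \<Longrightarrow> b \<in> carrier G \<Longrightarrow> tw a = tw b \<longleftrightarrow> a = b"
  by (metis tw_tw)

lemma cj_z: "g \<in> carrier G \<Longrightarrow> cj g z = z"
  by (simp add: cj_eq_iff z_central)

lemma u_neq_tw [simp]: "u \<noteq> tw \<one>"
  using u_neq(2) by (simp add: tw_def)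

lemma one_neq_tw_u [simp]: "\<one> \<noteq> tw u"
  by (metis C_carrier tw_tw u_C u_neq_tw)

lemma tw_eq: "a \<in> carrier G \<Longrightarrow> tw a = b \<Longrightarrow> a = tw b"
  by auto

lemma inv_tw [simp]: "a \<in> carrier G \<Longrightarrow> inv (tw a) = tw (inv a)"
  by (rule inv_equality) simp_all

lemma cj_tw [simp]: "g \<in> carrier G \<Longrightarrow> a \<in> carrier G \<Longrightarrow> cj g (tw a) = tw (cj g a)"
  by (simp add: cj_def)

lemma class_hom_tw: "class_hom f \<Longrightarrow> a \<in> carrier G \<Longrightarrow> f (tw a) = tw (f a)"
proof -
  assume f: "class_hom f" and a: "a \<in> carrier G"
  obtain g where "g \<in> carrier G" "f z = cj g z" using f z_carrier unfolding class_hom_def by blast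
  then have "f z = z" by (simp add: cj_z)
  then show ?thesis using class_hom_mult[OF f a z_carrier] by (simp add: tw_def)
qed

lemma V_C: "v \<in> V \<Longrightarrow> v \<in> C" by auto

lemma V_central: "v \<in> V \<Longrightarrow> c \<in> C \<Longrightarrow> v \<otimes> c = c \<otimes> v"
  using u_central[of c] by auto

lemma C_centerI: "v \<in> C \<Longrightarrow> (\<And>c. c \<in> C \<Longrightarrow> v \<otimes> c = c \<otimes> v) \<Longrightarrow> v \<in> V"
  using C_center[of v] by (simp only: V_eq)

lemma C_commuteD: "c \<in> C \<Longrightarrow> d \<in> C \<Longrightarrow> c \<otimes> d = d \<otimes> c \<Longrightarrow> c \<notin> V \<Longrightarrow> d \<in> V \<or> inv c \<otimes> d \<in> V"
  using C_commute[of c d] unfolding V_eq by blast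

lemma C_class_tw: "c \<in> C \<Longrightarrow> d \<in> C \<Longrightarrow> cj d c = c \<or> cj d c = tw c"
  using C_class[of c d] by (simp add: tw_def)

lemma cj_V: "v \<in> V \<Longrightarrow> c \<in> C \<Longrightarrow> cj c v = v"
  using V_central[of v c] V_C[of v] by (simp only: cj_eq_iff C_carrier)

lemma cj_C_commute: "c \<in> C \<Longrightarrow> d \<in> C \<Longrightarrow> c \<otimes> d \<noteq> d \<otimes> c \<Longrightarrow> cj d c = tw c"
  using C_class_tw[of c d] cj_eq_iff[of d c c] by auto

lemma V_cj_out: "g \<in> carrier G - C \<Longrightarrow> v \<in> {u, tw u} \<Longrightarrow> cj g v = tw v"
  using u_class[of g] by (auto simp flip: tw_def)

lemma V_cj: "g \<in> carrier G \<Longrightarrow> v \<in> V \<Longrightarrow> cj g v = v \<or> cj g v = tw v"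
  using V_cj_out[of g v] cj_V[of v g] by (cases "g \<in> C") auto

lemma V_tw: "v \<in> V \<Longrightarrow> tw v \<in> V"
  by auto

lemma V_cj': "g \<in> carrier G \<Longrightarrow> v \<in> V \<Longrightarrow> cj g v \<in> V"
  using V_cj[of g v] V_tw[of v] by metis

lemma V_mult: "v \<in> V \<Longrightarrow> w \<in> V \<Longrightarrow> v \<otimes> w \<in> V"
  by (rule C_centerI[OF C_mult[OF V_C V_C] commute_mult[OF C_carrier[OF V_C] C_carrier[OF V_C] C_carrier
        V_central V_central]])

text \<open>An element commutes with its square, so for c outside V \<open>C_commuteD\<close> leaves
  c \<otimes> c in V, the alternative being c itself.\<close>

lemma square_V: "c \<in> C \<Longrightarrow> c \<otimes> c \<in> V"
proof (cases "c \<in> V")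
  case False
  assume c: "c \<in> C"
  have "c \<otimes> c \<in> V \<or> inv c \<otimes> (c \<otimes> c) \<in> V"
    using c False by (intro C_commuteD C_mult) (simp_all add: m_assoc)
  then show ?thesis using c False l_inv_cancel(1)[of c c] by auto
qed (rule V_mult)

lemma C_noncommuting: "c \<in> C \<Longrightarrow> c \<notin> V \<Longrightarrow> \<exists>d\<in>C. c \<otimes> d \<noteq> d \<otimes> c"
  using C_centerI[of c] by blast

section \<open>Class preserving maps that are the identity on C up to z\<close>

lemma agrees_with_cj:
  assumes f: "class_hom f" and fC: "\<And>c. c \<in> C \<Longrightarrow> f c = c \<or> f c = tw c" and fu: "f u = u"
  shows "\<exists>d\<in>C. \<forall>c\<in>C. f c = cj d c"
proof -
  obtain a b where ab [simp]: "a \<in> C" "b \<in> C" and nc: "a \<otimes> b \<noteq> b \<otimes> a" using nonabelian by auto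
  have ba: "cj b a = tw a" using cj_C_commute[OF ab nc] .
  have ab': "cj a b = tw b" using cj_C_commute[OF ab(2,1) nc[symmetric]] .
  have aa: "cj a a = a" "cj b b = b" by (simp_all add: cj_eq_iff)
  have "\<exists>d\<in>C. f a = cj d a \<and> f b = cj d b"
  proof -
    consider "f a = a" "f b = b" | "f a = tw a" "f b = b" | "f a = a" "f b = tw b"
      | "f a = tw a" "f b = tw b" using fC[of a] fC[of b] by auto
    then show ?thesis
    proof cases
      case 1 then show ?thesis by (intro bexI[of _ \<one>]) simp_all
    next
      case 2 then show ?thesis by (intro bexI[of _ b]) (simp_all add: ba aa)
    next
      case 3 then show ?thesis by (intro bexI[of _ a]) (simp_all add: ab' aa)
    next
      case 4 then show ?thesis by (intro bexI[of _ "a \<otimes> b"]) (simp_all add: ab' ba aa flip: cj_cj)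
    qed
  qed
  then obtain d where d [simp]: "d \<in> C" and fd: "f a = cj d a" "f b = cj d b" by auto
  define S where "S = {c \<in> C. f c = cj d c}"
  have S_mult: "c \<otimes> c' \<in> S" if "c \<in> S" "c' \<in> S" for c c'
    using that f by (auto simp: S_def class_hom_mult cj_mult)
  have "V \<subseteq> S"
    using f fu cj_V[of u d] by (auto simp: S_def class_hom_one class_hom_tw)
  have commuting: "c \<in> S" if c: "c \<in> C" "a \<otimes> c = c \<otimes> a" for c
  proof -
    have "a \<notin> V" using nc V_central[of a b] by auto
    then consider "c \<in> V" | "inv a \<otimes> c \<in> V" using C_commuteD[of a c] c ab by blast
    then show ?thesis
    proof cases
      case 2
      have "a \<in> S" by (simp add: S_def fd)
      then have "a \<otimes> (inv a \<otimes> c) \<in> S"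
        using 2 \<open>V \<subseteq> S\<close> S_mult by blast
      then show ?thesis using c by simp
    qed (use \<open>V \<subseteq> S\<close> in auto)
  qed
  have "c \<in> S" if c: "c \<in> C" for c
  proof (cases "a \<otimes> c = c \<otimes> a")
    case False
    have "cj c a = tw a" using cj_C_commute[of a c] c False by simp
    \<comment> \<open>c and b both twist a, so c \<otimes> inv b commutes with a and the previous
      case applies to it.\<close>
    then have "cj (inv b) (cj c a) = cj (inv b) (cj b a)" by (simp only: ba)
    then have "cj (c \<otimes> inv b) a = a" using c by (simp add: cj_cj)
    then have "c \<otimes> inv b \<in> S" using c by (intro commuting) (simp_all add: cj_eq_iff)
    moreover have "b \<in> S" by (simp add: S_def fd)
    ultimately have "(c \<otimes> inv b) \<otimes> b \<in> S" by (rule S_mult)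
    then show ?thesis using c by (simp add: m_assoc)
  qed (use c commuting in auto)
  then show ?thesis using d by (auto simp: S_def)
qed

lemma order8_gensI':
  assumes "y \<in> carrier G" "x \<in> carrier G" "s \<in> carrier G"
    and y: "(y \<otimes> y) \<otimes> (y \<otimes> y) = tw \<one>" and x: "cj x y = tw y"
    and s: "cj s y = y \<otimes> (y \<otimes> y) \<or> cj s y = tw (y \<otimes> (y \<otimes> y))"
  shows order8_gens
proof (rule order8_gensI[OF assms(1-3) z_carrier z_neq zz z_central])
  show "(y \<otimes> y) \<otimes> (y \<otimes> y) = z" "cj x y = y \<otimes> z"
    "cj s y = y \<otimes> (y \<otimes> y) \<or> cj s y = y \<otimes> (y \<otimes> y) \<otimes> z"
    using y x s by (simp_all add: tw_def)
qed

text \<open>Once the conjugation by d is removed, the map g fixes C pointwise and sends t to t v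
  with v in V. For v = 1 or v = z it is conjugation by 1 or by u. The other two values force d to
  have order 8, with t acting on it by the exponent 3 or 7.\<close>

lemma inner_or_order8_fixing_u:
  assumes f: "class_hom f" and t: "t \<in> carrier G - C" and ft: "f t = t"
    and fC: "\<And>c. c \<in> C \<Longrightarrow> f c = c \<or> f c = tw c" and fu: "f u = u"
  shows "inner f \<or> order8_gens"
proof -
  have tc [simp]: "t \<in> carrier G" using t by simp
  obtain d where d [simp]: "d \<in> C" and fd: "\<And>c. c \<in> C \<Longrightarrow> f c = cj d c"
    using agrees_with_cj[OF f fC fu] by auto
  define g where "g = (\<lambda>x. cj (inv d) (f x))"
  have g: "class_hom g" unfolding g_def using f by (intro class_hom_comp) simp_all
  have gC: "g c = c" if "c \<in> C" for c using that by (simp add: g_def fd)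
  define v where "v = cj t d \<otimes> inv d"
  have vC [simp]: "v \<in> C" by (simp add: v_def C_normal)
  have gt: "g t = t \<otimes> v" by (simp add: g_def ft v_def cj_def m_assoc)
  \<comment> \<open>g fixes c' and its conjugate by t, so t and g t = t v act alike on C and v
    centralizes C.\<close>
  have "v \<in> V"
  proof (rule C_centerI)
    fix c assume c: "c \<in> C"
    define c' where "c' = cj (inv t) c"
    have c': "c' \<in> C" "cj t c' = c" using c by (simp_all add: c'_def C_normal)
    have "g (cj t c') = cj (t \<otimes> v) c'"
      by (simp only: class_hom_cj[OF g tc C_carrier[OF c'(1)]] gt gC[OF c'(1)])
    then have "cj v c = c" using c c' gC[of c] cj_cj[of t v c'] by simp
    then show "v \<otimes> c = c \<otimes> v" using c by (simp add: cj_eq_iff)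
  qed simp
  have extend: "inner g" if e: "e \<in> carrier G" and eC: "\<And>c. c \<in> C \<Longrightarrow> cj e c = c" and et: "cj e t = g t" for e
    by (rule inner_if_agrees[OF g C C_index2 t e]) (simp_all add: gC eC et)
  have ut: "cj u t = tw t"
  proof -
    have "u \<otimes> t = t \<otimes> tw u" using u_class[OF t] by (simp add: cj_eq_iff tw_def)
    then have "tw (t \<otimes> u) = u \<otimes> t" by simp
    then show ?thesis by (simp add: cj_eq_iff tw_eq)
  qed
  consider "v = \<one>" | "v = tw \<one>" | "v \<in> {u, tw u}" using \<open>v \<in> V\<close> by auto
  then show ?thesis
  proof cases
    case 1
    then have "inner g" using gt by (intro extend[of \<one>]) simp_all
    then show ?thesis using inner_of_comp[OF f, of "inv d"] by (simp add: g_def)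
  next
    case 2
    then have "inner g" using gt ut by (intro extend[of u]) (simp_all add: cj_eq_iff u_central)
    then show ?thesis using inner_of_comp[OF f, of "inv d"] by (simp add: g_def)
  next
    case 3
    \<comment> \<open>g fixes t \<otimes> t, which lies in C. Expanding the square of t v gives cj t
      v \<otimes> v = 1, and t twists v.\<close>
    have vv: "v \<otimes> v = tw \<one>"
    proof -
      have "t \<otimes> t \<in> C" using t by (intro C_index2)
      then have "t \<otimes> v \<otimes> (t \<otimes> v) = t \<otimes> t"
        using gC[of "t \<otimes> t"] by (simp add: class_hom_mult[OF g] gt)
      moreover have "t \<otimes> v \<otimes> (t \<otimes> v) = t \<otimes> t \<otimes> (cj t v \<otimes> v)"
        by (simp add: cj_def m_assoc)
      moreover have "cj t v = tw v" using V_cj_out[OF t 3] .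
      ultimately have "t \<otimes> t \<otimes> (tw v \<otimes> v) = t \<otimes> t \<otimes> \<one>" by simp
      then have "tw v \<otimes> v = \<one>" by (rule l_cancel) simp_all
      then have "tw (v \<otimes> v) = \<one>" by simp
      then show ?thesis by (simp add: tw_eq)
    qed
    have dt: "cj t d = d \<otimes> v"
      using V_central[OF \<open>v \<in> V\<close>, of d] by (simp add: v_def m_assoc C_normal)
    have vn: "v \<noteq> \<one>" "v \<noteq> tw \<one>" using 3 u_neq by (auto dest: tw_eq)
    have "d \<notin> V"
    proof
      assume "d \<in> V"
      then have "d \<otimes> v = d \<or> d \<otimes> v = tw (d \<otimes> \<one>)" using V_cj[of t d] dt by simp
      then have "d \<otimes> v = d \<otimes> \<one> \<or> d \<otimes> v = d \<otimes> tw \<one>" by simp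
      then show False using vn by (simp del: tw_mult_right r_one)
    qed
    then obtain e where e [simp]: "e \<in> C" and "d \<otimes> e \<noteq> e \<otimes> d" using C_noncommuting[of d] by auto
    then have ed: "cj e d = tw d" by (intro cj_C_commute) simp_all
    have "d \<otimes> v \<otimes> (d \<otimes> v) = d \<otimes> d \<otimes> (v \<otimes> v)"
      using V_central[OF \<open>v \<in> V\<close>, of d] by (metis C_carrier d m_assoc m_closed vC)
    \<comment> \<open>t moves the square of d, so this element of V is v or tw v. Its own square is
      z, hence d has order 8.\<close>
    then have ddt: "cj t (d \<otimes> d) = tw (d \<otimes> d)" by (simp add: cj_mult dt vv)
    have "d \<otimes> d \<in> V" by (rule square_V[OF d])
    moreover have "d \<otimes> d \<noteq> \<one>" "d \<otimes> d \<noteq> tw \<one>" using ddt by auto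
    ultimately have ddv: "d \<otimes> d = v \<or> d \<otimes> d = tw v" using 3 by auto
    then have dd: "v = d \<otimes> d \<or> v = tw (d \<otimes> d)" by auto
    have "order8_gens"
    proof (rule order8_gensI')
      show "(d \<otimes> d) \<otimes> (d \<otimes> d) = tw \<one>"
        using ddv vv by auto
      show "cj e d = tw d" by (rule ed)
      show "cj t d = d \<otimes> (d \<otimes> d) \<or> cj t d = tw (d \<otimes> (d \<otimes> d))"
        using dd unfolding dt by auto
    qed simp_all
    then show ?thesis ..
  qed
qed

text \<open>As f moves u, it fixes only 1 and z in V, so all squares in C are 1 or z and C has no
  element of order 8. The required y lies outside C: it is t or t a, whose square is b = inv a
  \<otimes> cj t a up to z, and b has square z. On y the element u acts by the exponent 5, and a by
  3 or 7.\<close>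

lemma inner_or_order8_moving_u:
  assumes f: "class_hom f" and t: "t \<in> carrier G - C" and ft: "f t = t"
    and fC: "\<And>c. c \<in> C \<Longrightarrow> f c = c \<or> f c = tw c" and fu: "f u = tw u"
    and a0: "a0 \<in> C" "inv a0 \<otimes> cj t a0 \<notin> V"
  shows "order8_gens"
proof -
  have tc [simp]: "t \<in> carrier G" using t by simp
  have V_fixed: "v = \<one> \<or> v = tw \<one>" if "v \<in> V" "f v = v" for v
    using that f fu by (auto simp: class_hom_tw)
  \<comment> \<open>If f twists a0, then it fixes a0 \<otimes> u, because it twists u too. The
    commutator with t changes only by z.\<close>
  obtain a where a [simp]: "a \<in> C" and fa: "f a = a" and aV: "inv a \<otimes> cj t a \<notin> V"
  proof (cases "f a0 = a0")
    case False
    then have fa0: "f a0 = tw a0" using fC[of a0] a0 by simp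
    have *: "cj t u = tw u" using t V_cj_out[of t u] by simp
    define w where "w = inv a0 \<otimes> cj t a0"
    have w [simp]: "w \<in> C" using a0 by (simp add: w_def C_normal)
    have "inv (a0 \<otimes> u) \<otimes> cj t (a0 \<otimes> u) = tw (inv u \<otimes> (w \<otimes> u))"
      using a0 by (simp add: inv_mult_group cj_mult * m_assoc w_def)
    also have "w \<otimes> u = u \<otimes> w" by (simp only: u_central w)
    also have "inv u \<otimes> (u \<otimes> w) = w" by simp
    finally have "inv (a0 \<otimes> u) \<otimes> cj t (a0 \<otimes> u) \<notin> V"
      using a0 V_tw[of "tw w"] by (auto simp flip: w_def)
    then show thesis
      using a0 fa0 fu by (intro that[of "a0 \<otimes> u"]) (simp_all add: class_hom_mult[OF f])
  qed (use a0 that in blast)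
  define b where "b = inv a \<otimes> cj t a"
  have b [simp]: "b \<in> C" by (simp add: b_def C_normal)
  have bV: "b \<notin> V" using aV by (simp add: b_def)
  have ta: "cj t a = a \<otimes> b" by (simp add: b_def)
  have squares: "c \<otimes> c = \<one> \<or> c \<otimes> c = tw \<one>" if c: "c \<in> C" for c
    using c f fC[OF c] by (intro V_fixed square_V) (auto simp: class_hom_mult)
  have a_V: "a \<notin> V"
  proof
    assume "a \<in> V"
    then have "cj t a = a \<otimes> \<one> \<or> cj t a = a \<otimes> tw \<one>" using V_cj[of t a] by simp
    then have "b = \<one> \<or> b = tw \<one>" by (simp add: ta del: tw_mult_right r_one)
    then show False using bV by auto
  qed
  \<comment> \<open>If a and b commuted, cj t a = a b would be the product of a \<otimes> a and inv
    a \<otimes> b, both in V; then a would be in V as well.\<close>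
  have nc: "a \<otimes> b \<noteq> b \<otimes> a"
  proof
    assume "a \<otimes> b = b \<otimes> a"
    then have "inv a \<otimes> b \<in> V" using C_commuteD[of a b] a_V bV by simp
    then have "(a \<otimes> a) \<otimes> (inv a \<otimes> b) \<in> V" by (rule V_mult[OF square_V[OF a]])
    moreover have "(a \<otimes> a) \<otimes> (inv a \<otimes> b) = cj t a" by (simp add: m_assoc ta)
    ultimately have "cj t a \<in> V" by (simp only:)
    then have "cj (inv t) (cj t a) \<in> V" by (rule V_cj'[OF inv_closed[OF tc]])
    then show False using a_V by simp
  qed
  have ab: "cj a b = tw b" using nc by (intro cj_C_commute) simp_all
  have ba: "cj b a = tw a" using nc by (intro cj_C_commute) simp_all
  \<comment> \<open>t fixes a \<otimes> a, which is 1 or z, so a b has the same square as a.\<close>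
  have bb: "b \<otimes> b = tw \<one>"
  proof -
    have "cj t (a \<otimes> a) = a \<otimes> a" using squares[of a] by auto
    then have "a \<otimes> b \<otimes> (a \<otimes> b) = a \<otimes> a" by (simp add: cj_mult ta)
    moreover have "a \<otimes> b \<otimes> (a \<otimes> b) = a \<otimes> a \<otimes> (cj a b \<otimes> b)"
      by (simp add: cj_def m_assoc)
    ultimately have "a \<otimes> a \<otimes> (tw b \<otimes> b) = a \<otimes> a \<otimes> \<one>" by (simp add: ab)
    then have "tw b \<otimes> b = \<one>" by (rule l_cancel) simp_all
    then have "tw (b \<otimes> b) = \<one>" by simp
    then show ?thesis by (simp add: tw_eq)
  qed
  have inv_b: "inv b = tw b" by (rule inv_equality) (simp_all add: bb)
  \<comment> \<open>t \<otimes> t lies in C and therefore changes a at most by z; conjugating a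
    twice by t yields the factor b \<otimes> cj t b.\<close>
  have tb: "cj t b = b \<or> cj t b = tw b"
  proof -
    have "t \<otimes> t \<in> C" using t by (intro C_index2)
    then have "cj (t \<otimes> t) a = a \<or> cj (t \<otimes> t) a = tw a" by (intro C_class_tw) simp_all
    moreover have "cj (t \<otimes> t) a = a \<otimes> (b \<otimes> cj t b)"
      by (simp add: ta cj_mult m_assoc flip: cj_cj)
    ultimately have "a \<otimes> (b \<otimes> cj t b) = a \<otimes> \<one> \<or> a \<otimes> (b \<otimes> cj t b) = a \<otimes> tw \<one>" by simp
    then have "b \<otimes> cj t b = \<one> \<or> b \<otimes> cj t b = tw \<one>" by (simp del: tw_mult_right r_one)
    then have "inv b \<otimes> (b \<otimes> cj t b) = inv b \<otimes> \<one> \<or> inv b \<otimes> (b \<otimes> cj t b) = inv b \<otimes> tw \<one>" by metis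
    moreover have "inv b \<otimes> (b \<otimes> cj t b) = cj t b" by simp
    ultimately have "cj t b = inv b \<otimes> \<one> \<or> cj t b = inv b \<otimes> tw \<one>" by (simp only:)
    then show ?thesis by (auto simp: inv_b)
  qed
  \<comment> \<open>If t twists b, so does a, and t \<otimes> a centralizes b.\<close>
  obtain t' where t': "t' \<in> carrier G - C" and t'b: "cj t' b = b" and t'a: "cj t' a = a \<otimes> b \<or> cj t' a = tw (a \<otimes> b)"
  proof (cases "cj t b = b")
    case False
    then have tb: "cj t b = tw b" using tb by simp
    have ta_C: "t \<otimes> a \<in> carrier G - C"
    proof -
      have "t \<otimes> a \<notin> C"
      proof
        assume "t \<otimes> a \<in> C"
        then have "t \<otimes> a \<otimes> inv a \<in> C" by (rule C_mult[OF _ C_inv[OF a]])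
        then show False using t by (simp add: m_assoc)
      qed
      then show ?thesis by simp
    qed
    have aa: "cj a a = a" by (simp add: cj_eq_iff)
    show thesis
      by (rule that[OF ta_C]) (simp_all add: tb ab ta aa cj_mult flip: cj_cj)
  qed (use t ta that in blast)
  have t'c [simp]: "t' \<in> carrier G" using t' by simp
  define q where "q = t' \<otimes> t'"
  have q [simp]: "q \<in> C" unfolding q_def using t' by (intro C_index2)
  have t'q: "cj t' q = q" by (simp add: q_def cj_eq_iff m_assoc)
  have t'V: "v = \<one> \<or> v = tw \<one>" if "v \<in> V" "cj t' v = v" for v
    using that V_cj_out[OF t', of v] by auto
  have "cj q b = b" by (simp add: q_def t'b flip: cj_cj)
  then have "b \<otimes> q = q \<otimes> b" by (simp add: cj_eq_iff)
  then consider "q \<in> V" | "inv b \<otimes> q \<in> V" using C_commuteD[of b q] bV b q by blast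
  then have q_b: "q = b \<or> q = tw b"
  proof cases
    \<comment> \<open>t' fixes its own square q, so q in V would be 1 or z and fix a. But
      conjugating a twice by t' gives a b b = tw a.\<close>
    case 1
    then have "cj q a = a" using t'V[OF _ t'q] by (auto simp: cj_eq_iff)
    moreover have "cj q a = a \<otimes> (b \<otimes> b)"
      using t'a by (auto simp: q_def cj_mult t'b m_assoc simp flip: cj_cj)
    ultimately show ?thesis by (simp add: bb)
  next
    case 2
    have "cj t' (inv b \<otimes> q) = inv b \<otimes> q" by (simp add: cj_mult cj_of_inv t'b t'q)
    then have "inv b \<otimes> q = \<one> \<or> inv b \<otimes> q = tw \<one>" using t'V[OF 2] by simp
    then have "b \<otimes> (inv b \<otimes> q) = b \<otimes> \<one> \<or> b \<otimes> (inv b \<otimes> q) = b \<otimes> tw \<one>" by metis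
    then show ?thesis by (simp del: tw_mult_left add: l_inv_cancel)
  qed
  show ?thesis
  proof (rule order8_gensI'[of t' u a])
    show "t' \<otimes> t' \<otimes> (t' \<otimes> t') = tw \<one>"
      using q_b bb by (auto simp flip: q_def)
    have "u \<otimes> t' = t' \<otimes> tw u" using V_cj_out[OF t', of u] by (simp add: cj_eq_iff)
    then have "tw (t' \<otimes> u) = u \<otimes> t'" by simp
    then show "cj u t' = tw t'" by (simp add: cj_eq_iff tw_eq)
    have "cj a t' = t' \<otimes> (inv (cj t' a) \<otimes> a)"
      by (simp add: cj_def inv_mult_group m_assoc)
    moreover have "inv (a \<otimes> b) \<otimes> a = tw b"
      by (simp add: inv_mult_group m_assoc inv_b)
    ultimately have "cj a t' = t' \<otimes> b \<or> cj a t' = tw (t' \<otimes> b)"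
      using t'a by auto
    then show "cj a t' = t' \<otimes> (t' \<otimes> t') \<or> cj a t' = tw (t' \<otimes> (t' \<otimes> t'))"
      using q_b by (auto simp flip: q_def)
  qed simp_all
qed

text \<open>If f moves u and t acts trivially on C modulo V, comparing f with conjugation by t shows
  that f fixes each v = inv c \<otimes> cj t c. So v is 1 or z, and f followed by conjugation by t
  is still the identity on C up to z. It fixes u, since f and t both twist u.\<close>

lemma inner_or_order8_aux:
  assumes f: "class_hom f" and t: "t \<in> carrier G - C" and ft: "f t = t"
    and fC: "\<And>c. c \<in> C \<Longrightarrow> f c = c \<or> f c = tw c"
  shows "inner f \<or> order8_gens"
proof (cases "f u = u")
  case True
  then show ?thesis using inner_or_order8_fixing_u[OF f t ft fC] by blast
next
  case False
  then have fu: "f u = tw u" using fC[of u] by simp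
  have tc [simp]: "t \<in> carrier G" using t by simp
  show ?thesis
  proof (cases "\<forall>a\<in>C. inv a \<otimes> cj t a \<in> V")
    case False
    then show ?thesis using inner_or_order8_moving_u[OF f t ft fC fu] by blast
  next
    case True
    have t_class: "cj t c = c \<or> cj t c = tw c" if c: "c \<in> C" for c
    proof -
      define v where "v = inv c \<otimes> cj t c"
      have v: "v \<in> V" using True c by (simp add: v_def)
      have tc: "cj t c = c \<otimes> v" using c by (simp add: v_def)
      have vC: "v \<in> C" using v by (rule V_C)
      have "f (c \<otimes> v) = cj t (f c)" using c f by (simp add: class_hom_cj ft flip: tc)
      then have "f c \<otimes> f v = cj t (f c)" using c vC f by (simp add: class_hom_mult)
      then have "f v = v" using fC[OF c] fC[OF vC] c vC by (auto simp: tc)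
      then have "v = \<one> \<or> v = tw \<one>" using v f fu by (auto simp: class_hom_tw)
      then show ?thesis using c by (auto simp: tc)
    qed
    define g where "g = (\<lambda>x. cj t (f x))"
    have g: "class_hom g" unfolding g_def using f by (intro class_hom_comp) simp_all
    have "inner g \<or> order8_gens"
    proof (rule inner_or_order8_fixing_u[OF g t])
      show "g t = t" by (simp add: g_def ft cj_eq_iff)
      show "g u = u" using V_cj_out[OF t, of "tw u"] by (simp add: g_def fu)
      fix c assume c: "c \<in> C"
      then show "g c = c \<or> g c = tw c" using fC[OF c] t_class[OF c] by (auto simp: g_def)
    qed
    then show ?thesis using inner_of_comp[OF f, of t] by (auto simp: g_def)
  qed
qed

lemma inner_or_order8:
  assumes f: "class_hom f" and C_proper: "C \<noteq> carrier G"
  shows "inner f \<or> order8_gens"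
proof -
  obtain t where t: "t \<in> carrier G - C" using C_proper C by (auto dest: subgroup.subset)
  then have tc [simp]: "t \<in> carrier G" by simp
  obtain k where k [simp]: "k \<in> carrier G" and ft: "f t = cj k t" using f tc unfolding class_hom_def by blast
  define g where "g = (\<lambda>x. cj (inv k) (f x))"
  have g: "class_hom g" unfolding g_def using f by (intro class_hom_comp) simp_all
  have gt: "g t = t" by (simp add: g_def ft)
  define S where "S = {c \<in> C. g c = c \<or> g c = tw c}"
  define T where "T = {c \<in> C. g c = cj t c \<or> g c = tw (cj t c)}"
  have "subgroup S G" "subgroup T G"
    by (intro subgroupI; use g C_one in \<open>auto simp: S_def T_def class_hom_mult class_hom_inv cj_mult cj_of_inv class_hom_one
          intro: exI[of _ "\<one>"]\<close>)+
  moreover have "C \<subseteq> S \<union> T"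
  proof
    fix c assume c: "c \<in> C"
    obtain h where h: "h \<in> carrier G" and gc: "g c = cj h c" using g C_carrier[OF c] unfolding class_hom_def by blast
    show "c \<in> S \<union> T"
    proof (cases "h \<in> C")
      case True
      then show ?thesis using C_class_tw[of c h] c by (auto simp: S_def gc)
    next
      case False
      have "inv t \<in> carrier G - C" using t C_inv[of "inv t"] by auto
      then have d: "h \<otimes> inv t \<in> C" using h False by (intro C_index2) auto
      \<comment> \<open>Outside C, h is d t with d in C. As d changes c at most by z, t may replace
        h up to z.\<close>
      have "cj h c = cj t (cj (h \<otimes> inv t) c)" using h c by (simp add: cj_cj m_assoc)
      then show ?thesis using C_class_tw[OF c d] c by (auto simp: T_def gc)
    qed
  qed
  ultimately have "C \<subseteq> S \<or> C \<subseteq> T" using subgroup_cover C by blast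
  then have "inner g \<or> order8_gens"
  proof
    assume "C \<subseteq> S"
    then show ?thesis by (intro inner_or_order8_aux[OF g t gt]) (auto simp: S_def)
  next
    assume "C \<subseteq> T"
    define g' where "g' = (\<lambda>x. cj (inv t) (g x))"
    have g': "class_hom g'" unfolding g'_def using g by (intro class_hom_comp) simp_all
    have "inner g' \<or> order8_gens"
    proof (rule inner_or_order8_aux[OF g' t])
      show "g' t = t" by (simp add: g'_def gt cj_eq_iff)
      fix c assume "c \<in> C"
      then show "g' c = c \<or> g' c = tw c" using \<open>C \<subseteq> T\<close> by (auto simp: g'_def T_def)
    qed
    then show ?thesis using inner_of_comp[OF g, of "inv t"] by (auto simp: g'_def)
  qed
  then show ?thesis using inner_of_comp[OF f, of "inv k"] by (auto simp: g_def)
qed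

end

section \<open>Centralizers in groups of order 32\<close>

lemma dvd_32:
  fixes n :: nat
  assumes "n dvd 32"
  shows "n \<in> {1, 2, 4, 8, 16, 32}"
proof -
  have "n dvd 2 ^ 5" using assms by simp
  then obtain i where "i \<le> 5" "n = 2 ^ i" using divides_primepow_nat[of 2 n 5] two_is_prime_nat by blast
  moreover have "i \<in> {0, 1, 2, 3, 4, 5}" using \<open>i \<le> 5\<close> by auto
  ultimately show ?thesis by auto
qed

section \<open>Centralizers, the centre and the class equation\<close>

context group
begin

definition centralizer :: "'a \<Rightarrow> 'a set" where
  "centralizer u = {g \<in> carrier G. g \<otimes> u = u \<otimes> g}"

definition center :: "'a set" where
  "center = {z \<in> carrier G. \<forall>g\<in>carrier G. z \<otimes> g = g \<otimes> z}"

definition conj_class :: "'a \<Rightarrow> 'a set" where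
  "conj_class u = (\<lambda>g. cj g u) ` carrier G"

lemma commute_inv:
  assumes c: "a \<in> carrier G" "c \<in> carrier G" and e: "a \<otimes> c = c \<otimes> a"
  shows "inv a \<otimes> c = c \<otimes> inv a"
proof -
  have "inv a \<otimes> (a \<otimes> c) \<otimes> inv a = inv a \<otimes> (c \<otimes> a) \<otimes> inv a" by (simp only: e)
  then show ?thesis using c by (simp add: m_assoc)
qed

lemma subgroup_centralizer:
  assumes u: "u \<in> carrier G"
  shows "subgroup (centralizer u) G"
proof (rule subgroupI)
  have "\<one> \<in> centralizer u" using u by (simp add: centralizer_def)
  then show "centralizer u \<noteq> {}" by blast
  fix a b assume a: "a \<in> centralizer u" and b: "b \<in> centralizer u"
  show "inv a \<in> centralizer u" using a u commute_inv unfolding centralizer_def by blast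
  show "a \<otimes> b \<in> centralizer u" using a b u commute_mult unfolding centralizer_def by blast
qed (auto simp: centralizer_def)

lemma center_commute: "z \<in> center \<Longrightarrow> g \<in> carrier G \<Longrightarrow> z \<otimes> g = g \<otimes> z"
  by (simp add: center_def)

lemma center_closed: "z \<in> center \<Longrightarrow> z \<in> carrier G"
  by (simp add: center_def)

lemma subgroup_center: "subgroup center G"
proof (rule subgroupI)
  have "\<one> \<in> center" by (simp add: center_def)
  then show "center \<noteq> {}" by blast
  fix a b assume a: "a \<in> center" and b: "b \<in> center"
  show "inv a \<in> center"
    using a commute_inv unfolding center_def by blast
  show "a \<otimes> b \<in> center"
    using a b commute_mult unfolding center_def by blast
qed (auto simp: center_def)

lemma center_subset_centralizer: "u \<in> carrier G \<Longrightarrow> center \<subseteq> centralizer u"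
  by (auto simp: center_def centralizer_def)

lemma centralizer_eq_carrier_iff:
  assumes "u \<in> carrier G"
  shows "centralizer u = carrier G \<longleftrightarrow> u \<in> center"
proof -
  have "centralizer u = carrier G \<longleftrightarrow> (\<forall>g\<in>carrier G. g \<otimes> u = u \<otimes> g)"
    unfolding centralizer_def by blast
  then show ?thesis using assms by (auto simp: center_def)
qed

lemma cj_eq_cj_iff:
  assumes "u \<in> carrier G" "g \<in> carrier G" "h \<in> carrier G"
  shows "cj g u = cj h u \<longleftrightarrow> g \<otimes> inv h \<in> centralizer u"
proof -
  have "cj g u = cj h u \<longleftrightarrow> cj (inv h) (cj g u) = u"
    using assms by (metis cj_closed cj_inv inv_closed)
  also have "\<dots> \<longleftrightarrow> g \<otimes> inv h \<in> centralizer u"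
    using assms by (auto simp: cj_cj cj_eq_iff centralizer_def)
  finally show ?thesis .
qed

text \<open>The carrier is counted by the fibres of g -> cj g u, each of which is a right coset of
  the centralizer.\<close>

lemma card_conj_class:
  assumes fin: "finite (carrier G)" and u: "u \<in> carrier G"
  shows "card (conj_class u) * card (centralizer u) = order G"
proof -
  interpret C: subgroup "centralizer u" G by (rule subgroup_centralizer[OF u])
  have fiber: "card {g \<in> carrier G. cj g u = y} = card (centralizer u)" if y: "y \<in> conj_class u" for y
  proof -
    obtain h where h: "h \<in> carrier G" "y = cj h u" using y by (auto simp: conj_class_def)
    have "bij_betw (\<lambda>c. c \<otimes> h) (centralizer u) {g \<in> carrier G. cj g u = y}"
    proof (rule bij_betw_byWitness[where f' = "\<lambda>g. g \<otimes> inv h"])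
      show "(\<lambda>c. c \<otimes> h) ` centralizer u \<subseteq> {g \<in> carrier G. cj g u = y}"
        using h u cj_eq_cj_iff[OF u _ h(1)] by (auto simp: m_assoc)
      show "(\<lambda>g. g \<otimes> inv h) ` {g \<in> carrier G. cj g u = y} \<subseteq> centralizer u"
        using h u cj_eq_cj_iff[OF u _ h(1)] by auto
    qed (use h in \<open>auto simp: m_assoc\<close>)
    then show ?thesis by (metis bij_betw_same_card)
  qed
  have "order G = (\<Sum>g\<in>carrier G. 1)" by (simp add: order_def)
  also have "\<dots> = (\<Sum>y\<in>conj_class u. \<Sum>g\<in>{g \<in> carrier G. cj g u = y}. 1)"
    unfolding conj_class_def by (rule sum.image_gen[OF fin])
  also have "\<dots> = (\<Sum>y\<in>conj_class u. card (centralizer u))"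
    by (rule sum.cong) (simp_all add: fiber)
  finally show ?thesis by simp
qed

lemma conj_class_eq:
  assumes "u \<in> carrier G" "v \<in> conj_class u"
  shows "conj_class v = conj_class u"
proof -
  obtain h where h: "h \<in> carrier G" "v = cj h u" using assms by (auto simp: conj_class_def)
  show ?thesis
  proof (intro equalityI subsetI)
    fix w assume "w \<in> conj_class v"
    then obtain g where g: "g \<in> carrier G" "w = cj g v" unfolding conj_class_def by blast
    have "cj g v = cj (h \<otimes> g) u" unfolding h(2) by (rule cj_cj[OF h(1) g(1) assms(1)])
    then have "w = cj (h \<otimes> g) u" by (simp only: g(2))
    then show "w \<in> conj_class u"
      unfolding conj_class_def by (rule image_eqI) (rule m_closed[OF h(1) g(1)])
  next
    fix w assume "w \<in> conj_class u"
    then obtain g where g: "g \<in> carrier G" "w = cj g u" unfolding conj_class_def by blast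
    have "cj (inv h \<otimes> g) v = cj g u"
      unfolding h(2) using h(1) g(1) assms(1) by (simp add: cj_cj)
    then have "w = cj (inv h \<otimes> g) v" by (simp only: g(2))
    then show "w \<in> conj_class v"
      unfolding conj_class_def by (rule image_eqI) (rule m_closed[OF inv_closed[OF h(1)] g(1)])
  qed
qed

text \<open>The noncentral elements are a disjoint union of classes. The case k = 2 gives a
  nontrivial centre; k = 4 serves the search for a centralizer of index 2.\<close>

lemma dvd_card_noncentral:
  assumes fin: "finite (carrier G)"
    and k: "\<And>u. u \<in> carrier G - center \<Longrightarrow> k dvd card (conj_class u)"
  shows "k dvd card (carrier G - center)"
proof -
  let ?S = "carrier G - center"
  have self: "u \<in> conj_class u" if "u \<in> carrier G" for u
    using that by (force simp: conj_class_def intro: image_eqI[of _ _ "\<one>"])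
  have sub: "conj_class u \<subseteq> ?S" if u: "u \<in> ?S" for u
  proof
    fix v assume v: "v \<in> conj_class u"
    then have vc: "v \<in> carrier G" using u by (auto simp: conj_class_def)
    have "u \<in> conj_class v" using conj_class_eq[OF _ v] self[of u] u by simp
    then have "v \<in> center \<Longrightarrow> u = v" by (auto simp: conj_class_def cj_eq_iff center_def)
    then show "v \<in> ?S" using u vc by auto
  qed
  have "\<Union> (conj_class ` ?S) = ?S" using sub self by fastforce
  moreover have "k dvd card (\<Union> (conj_class ` ?S))"
  proof (rule dvd_partition)
    show "finite (\<Union> (conj_class ` ?S))" using fin \<open>\<Union> (conj_class ` ?S) = ?S\<close> by simp
    show "\<forall>c\<in>conj_class ` ?S. k dvd card c" using k by blast
    show "\<forall>c1\<in>conj_class ` ?S. \<forall>c2\<in>conj_class ` ?S. c1 \<noteq> c2 \<longrightarrow> c1 \<inter> c2 = {}"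
    proof (intro ballI impI)
      fix c1 c2 assume "c1 \<in> conj_class ` ?S" "c2 \<in> conj_class ` ?S" "c1 \<noteq> c2"
      then obtain u v where "u \<in> ?S" "v \<in> ?S" "c1 = conj_class u" "c2 = conj_class v" by auto
      then show "c1 \<inter> c2 = {}" using conj_class_eq[of u] conj_class_eq[of v] \<open>c1 \<noteq> c2\<close>
        by (metis Diff_iff disjoint_iff)
    qed
  qed
  ultimately show ?thesis by simp
qed

lemma card_subgroup_dvd: "subgroup H G \<Longrightarrow> card H dvd order G"
  using lagrange[of H] by (metis dvd_triv_right)

end

section \<open>Centre and class sizes in order 32\<close>

locale group32 = group +
  assumes order32: "order G = 32"
begin

lemma fin: "finite (carrier G)"
  using order32 by (simp add: order_def card_ge_0_finite)

lemma subgroup_card: "subgroup H G \<Longrightarrow> card H \<in> {1, 2, 4, 8, 16, 32}"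
  using card_subgroup_dvd[of H] order32 by (intro dvd_32) simp

lemma subgroup_finite: "subgroup H G \<Longrightarrow> finite H"
  by (rule finite_subset[OF subgroup.subset fin])

lemma psubset_card: "H \<subset> K \<Longrightarrow> subgroup K G \<Longrightarrow> card H < card K"
  by (rule psubset_card_mono) (auto simp: subgroup_finite)

lemma card_carrier: "card (carrier G) = 32"
  using order32 by (simp add: order_def)

lemma noncentral_class:
  assumes u: "u \<in> carrier G - center"
  shows "card (conj_class u) \<in> {2, 4, 8, 16, 32}"
    and "card (conj_class u) * card (centralizer u) = 32"
proof -
  show 1: "card (conj_class u) * card (centralizer u) = 32"
    using card_conj_class[OF fin, of u] u order32 by simp
  then have "card (conj_class u) dvd 32" by (metis dvd_triv_left)
  moreover have "card (conj_class u) \<noteq> 1"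
  proof
    assume "card (conj_class u) = 1"
    then have "card (centralizer u) = card (carrier G)" using 1 card_carrier by simp
    then have "centralizer u = carrier G"
      using fin by (intro card_subset_eq) (auto simp: centralizer_def)
    then show False using u centralizer_eq_carrier_iff by blast
  qed
  ultimately show "card (conj_class u) \<in> {2, 4, 8, 16, 32}" using dvd_32 by auto
qed

lemma card_center_dvd:
  assumes k: "k dvd 32" and "\<And>u. u \<in> carrier G - center \<Longrightarrow> k dvd card (conj_class u)"
  shows "k dvd card center"
proof -
  have "k dvd card (carrier G - center)" using dvd_card_noncentral[OF fin assms(2)] .
  moreover have "card (carrier G) = card (carrier G - center) + card center"
    using card_Diff_subset[of center "carrier G"] subgroup_finite[OF subgroup_center]
      card_mono[OF fin, of center] center_closed by (simp add: subset_iff)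
  ultimately show ?thesis using k card_carrier by (metis dvd_add_right_iff)
qed

lemma even_card_center: "even (card center)"
proof (rule card_center_dvd)
  fix u assume "u \<in> carrier G - center"
  from noncentral_class(1)[OF this] show "2 dvd card (conj_class u)" by auto
qed simp

lemma center_nontrivial: "\<exists>z\<in>center. z \<noteq> \<one>"
proof (rule ccontr)
  assume "\<not> ?thesis"
  then have "center = {\<one>}" using subgroup.one_closed[OF subgroup_center] by blast
  then show False using even_card_center by simp
qed

text \<open>Otherwise the class equation leaves a centre of order 4 and, for noncentral u,
  centralizers made of the centre and its coset by u. Commutation becomes an alternating bilinear
  map with central values, written \<open>k\<close>. For suitable a, x, y independent modulo the
  centre, the few possible values of \<open>k x y\<close> each produce a commuting pair too large
  for such a centralizer.\<close>

lemma exists_index2_centralizer: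
  assumes nonab: "center \<noteq> carrier G"
  shows "\<exists>u\<in>carrier G. card (centralizer u) = 16"
proof (rule ccontr)
  assume no: "\<not> ?thesis"
  have cls: "card (conj_class u) \<in> {4, 8, 16, 32}" if u: "u \<in> carrier G - center" for u
    using noncentral_class[OF u] no u by auto
  have four: "4 dvd card center"
  proof (rule card_center_dvd)
    fix u assume "u \<in> carrier G - center"
    from cls[OF this] show "4 dvd card (conj_class u)" by auto
  qed simp
  have c8: "card (centralizer u) \<le> 8" if "u \<in> carrier G - center" for u
    using noncentral_class(2)[OF that] cls[OF that] by auto
  have psub: "center \<subset> centralizer u" if "u \<in> carrier G - center" for u
    using that center_subset_centralizer[of u] by (auto simp: centralizer_def)
  obtain a where a: "a \<in> carrier G - center" using nonab center_closed by blast
  have ac [simp]: "a \<in> carrier G" using a by simp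
  have "card center < card (centralizer a)"
    using a psub[OF a] by (intro psubset_card subgroup_centralizer) auto
  moreover have "card center > 0"
    using subgroup.one_closed[OF subgroup_center] subgroup_finite[OF subgroup_center] by (auto simp: card_gt_0_iff)
  ultimately have card_center: "card center = 4" using four c8[OF a] by (auto elim!: dvdE)
  note Zc [simp] = center_closed
  have cent: "c \<in> center \<or> inv u \<otimes> c \<in> center" if u: "u \<in> carrier G - center" and c: "c \<in> centralizer u" for u c
  proof -
    interpret Z: subgroup center G by (rule subgroup_center)
    have uc [simp]: "u \<in> carrier G" using u by simp
    have inj: "inj_on ((\<otimes>) u) center" by (rule inj_onI) simp
    have disj: "center \<inter> (\<otimes>) u ` center = {}"
    proof -
      have "u \<in> center" if "z \<in> center" "u \<otimes> z \<in> center" for z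
      proof -
        have "u \<otimes> z \<otimes> inv z \<in> center" using that by simp
        then show ?thesis using that by (simp add: m_assoc)
      qed
      then show ?thesis using u by auto
    qed
    have "card (center \<union> (\<otimes>) u ` center) = 8"
      using card_center disj subgroup_finite[OF subgroup_center]
      by (simp add: card_Un_disjoint card_image[OF inj])
    moreover have "center \<union> (\<otimes>) u ` center \<subseteq> centralizer u"
      using center_commute[of _ u] center_commute[of _ u] by (auto simp: centralizer_def m_assoc)
    ultimately have "center \<union> (\<otimes>) u ` center = centralizer u"
      using c8[OF u] subgroup_finite[OF subgroup_centralizer[OF uc]]
      by (metis card_seteq)
    then show ?thesis using c by auto
  qed
  have sq: "g \<otimes> g \<in> center" if g: "g \<in> carrier G" for g
  proof (cases "g \<in> center")
    case True
    then show ?thesis using subgroup.m_closed[OF subgroup_center] by blast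
  next
    case False
    then show ?thesis using cent[of g "g \<otimes> g"] g by (auto simp: centralizer_def m_assoc)
  qed
  define k where "k g h = inv g \<otimes> cj h g" for g h
  have k_center: "k g h \<in> center" if [simp]: "g \<in> carrier G" "h \<in> carrier G" for g h
  proof -
    interpret Z: subgroup center G by (rule subgroup_center)
    \<comment> \<open>A commutator is a product of squares, and squares are central by
      \<open>sq\<close>.\<close>
    have "k g h = inv (g \<otimes> g) \<otimes> ((g \<otimes> inv h) \<otimes> (g \<otimes> inv h)) \<otimes> (h \<otimes> h)"
      by (simp add: k_def cj_def m_assoc inv_mult_group)
    then show ?thesis using sq[of g] sq[of h] sq[of "g \<otimes> inv h"] by simp
  qed
  have kc [simp]: "k g h \<in> carrier G" if "g \<in> carrier G" "h \<in> carrier G" for g h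
    using that by (simp add: k_def)
  have cj_k: "cj h g = g \<otimes> k g h" if "g \<in> carrier G" "h \<in> carrier G" for g h
    using that by (simp add: k_def)
  have kcomm: "k g h \<otimes> w = w \<otimes> k g h" if "g \<in> carrier G" "h \<in> carrier G" "w \<in> carrier G" for g h w
    using that k_center center_commute by blast
  have k_left: "k (g \<otimes> g') h = k g h \<otimes> k g' h" if [simp]: "g \<in> carrier G" "g' \<in> carrier G" "h \<in> carrier G" for g g' h
  proof -
    have "k (g \<otimes> g') h = inv g' \<otimes> (k g h \<otimes> cj h g')"
      by (simp add: k_def cj_mult inv_mult_group m_assoc)
    also have "\<dots> = inv g' \<otimes> (cj h g' \<otimes> k g h)"
      by (simp only: kcomm[OF that(1,3) cj_closed[OF that(3,2)]])
    also have "\<dots> = k g' h \<otimes> k g h" by (simp add: k_def[of g'] m_assoc)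
    finally show ?thesis using kcomm[OF that(2,3) kc[OF that(1,3)]] by (rule HOL.trans)
  qed
  have k_right: "k g (h \<otimes> h') = k g h \<otimes> k g h'" if [simp]: "g \<in> carrier G" "h \<in> carrier G" "h' \<in> carrier G" for g h h'
  proof -
    have "cj h' (k g h) = k g h"
      by (simp only: cj_eq_iff[OF that(3) kc kc] kcomm that)
    then have "cj (h \<otimes> h') g = cj h' g \<otimes> k g h" by (simp add: cj_k[of g h] cj_mult flip: cj_cj)
    then have "k g (h \<otimes> h') = k g h' \<otimes> k g h" by (simp add: k_def[of g "h \<otimes> h'"] k_def[of g h'] m_assoc)
    then show ?thesis using kcomm[OF that(1,3) kc[OF that(1,2)]] by (rule HOL.trans)
  qed
  have k_self: "k g g = \<one>" if "g \<in> carrier G" for g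
    using that by (simp add: k_def cj_def)
  have k_center1: "k g z = \<one>" "k z g = \<one>" if "g \<in> carrier G" "z \<in> center" for g z
  proof -
    have "cj z g = g" "cj g z = z" using that center_commute[of z g] by (simp_all add: cj_eq_iff)
    then show "k g z = \<one>" "k z g = \<one>" using that by (simp_all add: k_def)
  qed
  have k_sq: "k g h \<otimes> k g h = \<one>" if "g \<in> carrier G" "h \<in> carrier G" for g h
    using k_left[of g g h] k_center1(2)[of h "g \<otimes> g"] sq[of g] that by simp
  have k_one: "k g h = \<one> \<longleftrightarrow> h \<in> centralizer g" if "g \<in> carrier G" "h \<in> carrier G" for g h
  proof -
    have "k g h = \<one> \<longleftrightarrow> cj h g = g" using that by (simp add: k_def inv_solve_left')
    also have "\<dots> \<longleftrightarrow> h \<in> centralizer g" using that by (auto simp: cj_eq_iff centralizer_def)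
    finally show ?thesis .
  qed
  \<comment> \<open>If x and y commute and neither commutes with a, then y lies in the coset of x
    modulo the centre, so both have the same commutator with a.\<close>
  have k_sym: "k a y = k a x" if "k x y = \<one>" "x \<in> carrier G" "y \<in> carrier G" "k a x \<noteq> \<one>" "k a y \<noteq> \<one>" for x y
  proof -
    have "x \<notin> center" using that k_center1(1)[OF ac, of x] by auto
    moreover have "y \<in> centralizer x" using that k_one by blast
    ultimately have "y \<in> center \<or> inv x \<otimes> y \<in> center" using cent[of x y] that by blast
    moreover have "y \<notin> center" using that k_center1(1)[OF ac, of y] by auto
    ultimately have "k a (inv x \<otimes> y) = \<one>" using k_center1(1)[OF ac] by blast
    moreover have "k a (x \<otimes> (inv x \<otimes> y)) = k a x \<otimes> k a (inv x \<otimes> y)" using that by (intro k_right) simp_all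
    ultimately show ?thesis using that by simp
  qed
  have "centralizer a \<noteq> carrier G" using a centralizer_eq_carrier_iff by blast
  then obtain x where x [simp]: "x \<in> carrier G" and "x \<notin> centralizer a" by (auto simp: centralizer_def)
  then have p1: "k a x \<noteq> \<one>" using k_one by simp
  \<comment> \<open>These two cosets have at most 16 elements. A y outside them has a commutator
    with a that differs from 1 and from \<open>k a x\<close>.\<close>
  have "centralizer a \<union> (\<lambda>c. c \<otimes> x) ` centralizer a \<noteq> carrier G"
  proof
    assume e: "centralizer a \<union> (\<lambda>c. c \<otimes> x) ` centralizer a = carrier G"
    have "card (centralizer a \<union> (\<lambda>c. c \<otimes> x) ` centralizer a) \<le> card (centralizer a) + card (centralizer a)"
      using card_Un_le[of "centralizer a" "(\<lambda>c. c \<otimes> x) ` centralizer a"]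
        card_image_le[OF subgroup_finite[OF subgroup_centralizer[OF ac]], of "\<lambda>c. c \<otimes> x"] by linarith
    then show False using e c8[OF a] card_carrier by simp
  qed
  then obtain y where y [simp]: "y \<in> carrier G" and y1: "y \<notin> centralizer a"
    and y2: "y \<notin> (\<lambda>c. c \<otimes> x) ` centralizer a"
    by (auto simp: centralizer_def)
  have q1: "k a y \<noteq> \<one>" using k_one y1 by simp
  have qp: "k a y \<noteq> k a x"
  proof
    assume "k a y = k a x"
    then have "cj y a = cj x a" by (simp add: cj_k)
    then have "y \<otimes> inv x \<in> centralizer a" by (simp add: cj_eq_cj_iff)
    moreover have "y = y \<otimes> inv x \<otimes> x" by (simp add: m_assoc)
    ultimately show False using y2 by blast
  qed
  \<comment> \<open>1, p, q and p q exhaust the centre, so r is one of them. Multiplying x by a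
    changes r by q, multiplying y by a changes it by p; every value of r thus gives a commuting pair
    excluded by \<open>k_sym\<close>.\<close>
  define p q r where "p = k a x" and "q = k a y" and "r = k x y"
  have pqr [simp]: "p \<in> carrier G" "q \<in> carrier G" "r \<in> carrier G" by (simp_all add: p_def q_def r_def)
  have pp: "p \<otimes> p = \<one>" and qq: "q \<otimes> q = \<one>" by (simp_all add: p_def q_def k_sq)
  have pq: "p \<otimes> q = q \<otimes> p" by (simp add: p_def kcomm)
  have xa: "k x a = p"
  proof -
    have "k (a \<otimes> x) (a \<otimes> x) = k a a \<otimes> k a x \<otimes> (k x a \<otimes> k x x)"
      by (simp only: k_left[OF ac x m_closed[OF ac x]] k_right[OF ac ac x] k_right[OF x ac x])
    then have "p \<otimes> k x a = \<one>" by (simp add: k_self p_def)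
    then have "p \<otimes> (p \<otimes> k x a) = p" by simp
    then show ?thesis by (simp add: pp flip: m_assoc)
  qed
  have "r \<noteq> \<one>" using k_sym[of x y] p1 q1 qp by (auto simp: r_def)
  moreover have "r \<otimes> p \<noteq> \<one>"
    using k_sym[of x "y \<otimes> a"] p1 q1 qp by (auto simp: r_def k_right k_self xa)
  moreover have "r \<otimes> q \<noteq> \<one>"
    using k_sym[of "x \<otimes> a" y] p1 q1 qp by (auto simp: r_def q_def k_right k_left k_self)
  moreover have "r \<otimes> q \<otimes> p \<noteq> \<one>"
  proof -
    have "k (x \<otimes> a) (y \<otimes> a) = r \<otimes> q \<otimes> p"
      by (simp only: k_left[OF x ac m_closed[OF y ac]] k_right[OF ac y ac] k_right[OF x y ac])
        (simp add: k_self xa m_assoc pq flip: r_def q_def)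
    then show ?thesis using k_sym[of "x \<otimes> a" "y \<otimes> a"] p1 q1 qp by (auto simp: k_right k_self)
  qed
  moreover have "r \<in> {\<one>, p, q, p \<otimes> q}"
  proof -
    have "{\<one>, p, q, p \<otimes> q} = center"
    proof (rule card_subset_eq[OF subgroup_finite[OF subgroup_center]])
      show "{\<one>, p, q, p \<otimes> q} \<subseteq> center"
        using subgroup.one_closed[OF subgroup_center] subgroup.m_closed[OF subgroup_center]
        by (auto simp: p_def q_def k_center)
      have "p \<otimes> q \<noteq> \<one>"
      proof
        assume "p \<otimes> q = \<one>"
        then have "p \<otimes> (p \<otimes> q) = p" by simp
        moreover have "p \<otimes> (p \<otimes> q) = q" by (simp add: pp flip: m_assoc)
        ultimately show False using qp by (simp add: p_def q_def)
      qed
      moreover have "p \<noteq> \<one>" "q \<noteq> \<one>" "q \<noteq> p" using p1 q1 qp by (simp_all add: p_def q_def)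
      ultimately show "card {\<one>, p, q, p \<otimes> q} = card center"
        using card_center by (auto simp: card_insert_if)
    qed
    then show ?thesis using k_center[of x y] by (simp add: r_def)
  qed
  moreover have "p \<otimes> q \<otimes> q \<otimes> p = \<one>" by (simp add: m_assoc[of p q q] qq pp)
  ultimately show False using pp qq by auto
qed

end

section \<open>Subgroups of index 2, and the two cases for C\<close>

context group
begin

text \<open>K is the union of H and the coset of H by inv a, which contains b. The ambient K is
  variable because the lemma is applied inside centralizers as well as in G.\<close>

lemma index2_mult_mem:
  assumes H: "subgroup H G" and K: "subgroup K G" and HK: "H \<subseteq> K"
    and card: "card K = 2 * card H" "finite K" and a: "a \<in> K - H" and b: "b \<in> K - H"
  shows "a \<otimes> b \<in> H"
proof -
  interpret H: subgroup H G by fact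
  interpret K: subgroup K G by fact
  have ac [simp]: "a \<in> carrier G" and bc [simp]: "b \<in> carrier G" using a b by auto
  have inj: "inj_on ((\<otimes>) (inv a)) H" by (rule inj_onI) simp
  have disj: "H \<inter> (\<otimes>) (inv a) ` H = {}"
  proof -
    have False if h: "h \<in> H" "inv a \<otimes> h \<in> H" for h
    proof -
      have "h \<otimes> inv (inv a \<otimes> h) \<in> H" using h by simp
      also have "h \<otimes> inv (inv a \<otimes> h) = a" using h by (simp add: inv_mult_group)
      finally show False using a by simp
    qed
    then show ?thesis by auto
  qed
  have "finite H" using card(2) HK by (rule finite_subset[rotated])
  then have "card (H \<union> (\<otimes>) (inv a) ` H) = card K"
    using disj card(1) by (simp add: card_Un_disjoint card_image[OF inj])
  moreover have "H \<union> (\<otimes>) (inv a) ` H \<subseteq> K" using HK a by auto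
  ultimately have "H \<union> (\<otimes>) (inv a) ` H = K" using card(2) by (intro card_subset_eq)
  then obtain h where "h \<in> H" "b = inv a \<otimes> h" using b by auto
  then show ?thesis by simp
qed

end

context group32
begin

lemma index2_mult:
  assumes C: "subgroup C G" "card C = 16" and g: "g \<in> carrier G - C" "h \<in> carrier G - C"
  shows "g \<otimes> h \<in> C"
  by (rule index2_mult_mem[OF C(1) subgroup_self _ _ fin g])
    (use C card_carrier in \<open>auto dest: subgroup.mem_carrier\<close>)

lemma index2_normal:
  assumes C: "subgroup C G" "card C = 16" and g: "g \<in> carrier G" and c: "c \<in> C"
  shows "cj g c \<in> C"
proof -
  interpret C: subgroup C G by fact
  have cc [simp]: "c \<in> carrier G" using c by simp
  show ?thesis
  proof (cases "g \<in> C")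
    case True
    then show ?thesis using c by (simp add: cj_def)
  next
    case False
    \<comment> \<open>The conjugate is the product of inv g \<otimes> c and g, both outside
      C.\<close>
    have "inv g \<otimes> c \<notin> C"
    proof
      assume "inv g \<otimes> c \<in> C"
      then have "c \<otimes> inv (inv g \<otimes> c) \<in> C" using c by simp
      then show False using False g by (simp add: inv_mult_group)
    qed
    then have "inv g \<otimes> c \<otimes> g \<in> C" using g False by (intro index2_mult[OF C]) auto
    then show ?thesis by (simp add: cj_def)
  qed
qed

lemma inner_if_abelian_index2:
  assumes f: "class_hom f" and C: "subgroup C G" "card C = 16"
    and ab: "\<And>c d. c \<in> C \<Longrightarrow> d \<in> C \<Longrightarrow> c \<otimes> d = d \<otimes> c"
  shows "inner f"
proof -
  note index2 = index2_mult[OF C]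
  have Cc [simp]: "c \<in> carrier G" if "c \<in> C" for c using C(1) that by (rule subgroup.mem_carrier)
  have "C \<noteq> carrier G" using C(2) card_carrier by auto
  then obtain t where t: "t \<in> carrier G - C" using Cc by auto
  then have tc [simp]: "t \<in> carrier G" by simp
  obtain k where k [simp]: "k \<in> carrier G" and ft: "f t = cj k t" using f tc unfolding class_hom_def by blast
  define g where "g = (\<lambda>x. cj (inv k) (f x))"
  have g: "class_hom g" unfolding g_def using f by (intro class_hom_comp) simp_all
  have gt: "g t = t" by (simp add: g_def ft)
  have "\<one> \<in> C" using C(1) by (rule subgroup.one_closed)
  define S where "S = {c \<in> C. g c = c}"
  define T where "T = {c \<in> C. g c = cj t c}"
  have "subgroup S G" "subgroup T G"
    by (intro subgroupI; use g \<open>\<one> \<in> C\<close> C(1) in \<open>auto simp: S_def T_def class_hom_mult class_hom_inv cj_mult cj_of_inv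
          class_hom_one subgroup.m_closed subgroup.m_inv_closed intro: exI[of _ "\<one>"]\<close>)+
  moreover have "C \<subseteq> S \<union> T"
  proof
    fix c assume c: "c \<in> C"
    obtain h where h: "h \<in> carrier G" and gc: "g c = cj h c" using g Cc[OF c] unfolding class_hom_def by blast
    have fix_c: "cj d c = c" if "d \<in> C" for d using ab[OF c that] c that by (simp add: cj_eq_iff)
    show "c \<in> S \<union> T"
    proof (cases "h \<in> C")
      case True
      then show ?thesis using fix_c c by (auto simp: S_def gc)
    next
      case False
      have "inv t \<in> carrier G - C" using t subgroup.m_inv_closed[OF C(1), of "inv t"] by auto
      then have d: "h \<otimes> inv t \<in> C" using h False by (intro index2) auto
      have "cj h c = cj t (cj (h \<otimes> inv t) c)" using h c by (simp add: cj_cj m_assoc)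
      then show ?thesis using fix_c[OF d] c by (auto simp: T_def gc)
    qed
  qed
  ultimately have "C \<subseteq> S \<or> C \<subseteq> T" using subgroup_cover C(1) by blast
  then have "inner g"
  proof
    assume "C \<subseteq> S"
    then show ?thesis using gt by (intro inner_if_agrees[OF g C(1) index2 t one_closed]) (auto simp: S_def)
  next
    assume "C \<subseteq> T"
    moreover have "cj t t = t" by (simp add: cj_eq_iff)
    ultimately show ?thesis using gt by (intro inner_if_agrees[OF g C(1) index2 t tc]) (auto simp: T_def)
  qed
  then show ?thesis using inner_of_comp[OF f, of "inv k"] by (simp add: g_def)
qed

text \<open>For c in C but not in Z(C), the proper inclusions of Z(G), Z(C), the centralizer of c in
  C, and C force the orders 2, 4, 8, 16, since all are powers of 2 and Z(G) is nontrivial. All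
  nontrivial commutators of C turn out to be equal; their common value is invariant under
  conjugation by G, so it is z.\<close>

lemma small_center_if_nonabelian_centralizer:
  assumes u [simp]: "u \<in> carrier G" and C16: "card (centralizer u) = 16"
    and nonab: "\<exists>a\<in>centralizer u. \<exists>b\<in>centralizer u. a \<otimes> b \<noteq> b \<otimes> a"
  shows "\<exists>z. small_center G (centralizer u) u z"
proof -
  define C where "C = centralizer u"
  have C: "subgroup C G" "card C = 16"
    unfolding C_def by (rule subgroup_centralizer[OF u], rule C16)
  interpret C: subgroup C G by (rule C(1))
  note normal = index2_normal[OF C]
  have uC: "u \<in> C" unfolding C_def centralizer_def by simp
  have u_comm: "u \<otimes> c = c \<otimes> u" if "c \<in> C" for c
    using that unfolding C_def centralizer_def by simp
  obtain a0 b0 where a0: "a0 \<in> C" and b0: "b0 \<in> C" and nc0: "a0 \<otimes> b0 \<noteq> b0 \<otimes> a0"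
    using nonab by (auto simp: C_def)
  define V where "V = {v \<in> C. \<forall>c\<in>C. v \<otimes> c = c \<otimes> v}"
  have V_sub: "subgroup V G"
  proof (rule subgroupI)
    have "\<one> \<in> V" by (simp add: V_def)
    then show "V \<noteq> {}" by blast
    fix a b assume a: "a \<in> V" and b: "b \<in> V"
    show "inv a \<in> V" using a commute_inv C.mem_carrier C.m_inv_closed unfolding V_def by blast
    show "a \<otimes> b \<in> V" using a b commute_mult C.mem_carrier C.m_closed unfolding V_def by blast
  qed (auto simp: V_def)
  interpret V: subgroup V G by (rule V_sub)
  have VC: "V \<subseteq> C" by (auto simp: V_def)
  have "u \<notin> center"
    using centralizer_eq_carrier_iff[OF u] C16 card_carrier by auto
  have "center \<subseteq> C" unfolding C_def by (rule center_subset_centralizer) simp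
  then have "center \<subseteq> V" using center_commute C.mem_carrier unfolding V_def by blast
  moreover have uV: "u \<in> V" using uC u_comm by (simp add: V_def)
  ultimately have "center \<subset> V" using \<open>u \<notin> center\<close> by blast
  then have c1: "card center < card V" by (rule psubset_card[OF _ V_sub])
  define K where "K c = C \<inter> centralizer c" for c
  have K_sub: "subgroup (K c) G" if "c \<in> C" for c
    unfolding K_def using that by (intro subgroups_Inter_pair C subgroup_centralizer) simp
  have K_mem: "d \<in> K c \<longleftrightarrow> d \<in> C \<and> c \<otimes> d = d \<otimes> c" if "c \<in> C" for c d
    unfolding K_def centralizer_def using C.mem_carrier by auto
  have VK: "V \<subset> K c" if c: "c \<in> C - V" for c
  proof
    show "V \<subseteq> K c" using c VC by (auto simp: K_mem V_def)
    have "c \<in> K c" using c by (simp add: K_mem)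
    then show "V \<noteq> K c" using c by blast
  qed
  have KC: "K c \<subset> C" if c: "c \<in> C - V" for c
  proof
    show "K c \<subseteq> C" by (auto simp: K_def)
    show "K c \<noteq> C" using c K_mem[of c] unfolding V_def by blast
  qed
  have a0V: "a0 \<in> C - V" using a0 b0 nc0 by (auto simp: V_def)
  have cardK: "card V < card (K c)" "card (K c) < 16" if "c \<in> C - V" for c
    using psubset_card[OF VK[OF that] K_sub] psubset_card[OF KC[OF that] C(1)] C(2) that by auto
  have center2: "card center = 2" and V4: "card V = 4"
    using subgroup_card[OF V_sub] subgroup_card[OF subgroup_center] even_card_center c1 cardK[OF a0V]
      subgroup_card[OF K_sub[OF a0]] by auto
  have K8: "card (K c) = 8" if "c \<in> C - V" for c
    using subgroup_card[OF K_sub, of c] cardK[OF that] V4 that by auto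
  obtain z where z: "z \<in> center" "z \<noteq> \<one>" using center_nontrivial by blast
  have zc [simp]: "z \<in> carrier G" using z center_closed by blast
  have zz: "z \<otimes> z = \<one>" and center_eq: "center = {\<one>, z}"
  proof -
    have "{\<one>, z} = center"
      using z subgroup.one_closed[OF subgroup_center] center2 subgroup_finite[OF subgroup_center]
      by (intro card_subset_eq) auto
    then show "center = {\<one>, z}" ..
    then have "z \<otimes> z \<in> {\<one>, z}" using subgroup.m_closed[OF subgroup_center z(1) z(1)] by simp
    then show "z \<otimes> z = \<one>" using z(2) by auto
  qed
  have z_comm: "z \<otimes> g = g \<otimes> z" if "g \<in> carrier G" for g
    using center_commute[OF z(1) that] .
  have zC: "z \<in> C" and zV: "z \<in> V" using \<open>center \<subseteq> C\<close> \<open>center \<subset> V\<close> z by auto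
  have u1: "u \<noteq> \<one>" "u \<noteq> z" using \<open>u \<notin> center\<close> center_eq by auto
  have V_eq: "V = {\<one>, z, u, u \<otimes> z}"
  proof (rule card_subset_eq[symmetric])
    show "finite V" by (rule subgroup_finite[OF V_sub])
    show "{\<one>, z, u, u \<otimes> z} \<subseteq> V" using zV uV V.m_closed[OF uV zV] by simp
    have "u \<otimes> z \<noteq> \<one>"
    proof
      assume "u \<otimes> z = \<one>"
      then have "u \<otimes> z \<otimes> z = z" by simp
      then show False using u1 by (simp add: m_assoc zz)
    qed
    then show "card {\<one>, z, u, u \<otimes> z} = card V" using z(2) u1 V4 by (auto simp: card_insert_if)
  qed
  have commute: "d \<in> V \<or> inv c \<otimes> d \<in> V" if c: "c \<in> C" "c \<notin> V" and d: "d \<in> C" and cd: "c \<otimes> d = d \<otimes> c" for c d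
  proof (rule disjCI)
    assume "inv c \<otimes> d \<notin> V"
    show "d \<in> V"
    proof (rule ccontr)
      assume "d \<notin> V"
      have "inv c \<notin> V" using c V.m_inv_closed[of "inv c"] by auto
      moreover have "inv c \<in> K c" using c commute_inv[of c c] by (simp add: K_mem)
      moreover have "d \<in> K c" using c d cd by (simp add: K_mem)
      ultimately have "inv c \<otimes> d \<in> V"
        using VK[of c] K8[of c] V4 c \<open>d \<notin> V\<close> subgroup_finite[OF K_sub[OF c(1)]]
        by (intro index2_mult_mem[OF V_sub K_sub[OF c(1)]]) auto
      then show False using \<open>inv c \<otimes> d \<notin> V\<close> by blast
    qed
  qed
  have sq: "c \<otimes> c \<in> V" if c: "c \<in> C" for c
  proof (cases "c \<in> V")
    case False
    then show ?thesis using commute[of c "c \<otimes> c"] c by (auto simp: m_assoc)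
  qed (rule V.m_closed)
  define k where "k c d = inv c \<otimes> cj d c" for c d
  have k_V: "k c d \<in> V" if [simp]: "c \<in> C" "d \<in> C" for c d
  proof -
    have "k c d = inv (c \<otimes> c) \<otimes> ((c \<otimes> inv d) \<otimes> (c \<otimes> inv d)) \<otimes> (d \<otimes> d)"
      by (simp add: k_def cj_def m_assoc inv_mult_group)
    then show ?thesis using sq[of c] sq[of d] sq[of "c \<otimes> inv d"] by simp
  qed
  have notV: "c \<in> C - V" "d \<in> C - V" if "c \<in> C" "d \<in> C" "c \<otimes> d \<noteq> d \<otimes> c" for c d
    using that not_sym[OF that(3)] unfolding V_def by blast+
  \<comment> \<open>The elements of C outside \<open>K c\<close> form a single coset of
    \<open>K c\<close>, so they all conjugate c alike.\<close>
  have k_const: "k c d = k c d'"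
    if c: "c \<in> C" and d: "d \<in> C" "c \<otimes> d \<noteq> d \<otimes> c" "d' \<in> C" "c \<otimes> d' \<noteq> d' \<otimes> c" for c d d'
  proof -
    have cV: "c \<in> C - V" using notV c d by blast
    have "inv d' \<notin> K c"
      using subgroup.m_inv_closed[OF K_sub[OF c], of "inv d'"] c d by (auto simp: K_mem)
    moreover have "d \<notin> K c" using c d by (simp add: K_mem)
    ultimately have "d \<otimes> inv d' \<in> K c"
      using KC[OF cV] K8[OF cV] C subgroup_finite[OF C(1)] d
      by (intro index2_mult_mem[OF K_sub[OF c] C(1)]) auto
    then have "cj d c = cj d' c" using c d by (simp add: cj_eq_cj_iff K_def)
    then show ?thesis by (simp add: k_def)
  qed
  have k_inv: "k d c = inv (k c d)" if "c \<in> C" "d \<in> C" for c d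
    using that by (simp add: k_def cj_def inv_mult_group m_assoc)
  \<comment> \<open>C is not covered by \<open>K c\<close> and \<open>K c'\<close>, so some e
    commutes with neither c nor c'. It links the two commutators by way of
    \<open>k_inv\<close>.\<close>
  have k_all: "k c d = k c' d'"
    if cd: "c \<in> C" "d \<in> C" "c \<otimes> d \<noteq> d \<otimes> c" and cd': "c' \<in> C" "d' \<in> C" "c' \<otimes> d' \<noteq> d' \<otimes> c'" for c d c' d'
  proof -
    have cV: "c \<in> C - V" "c' \<in> C - V" using notV cd cd' by blast+
    have "\<not> C \<subseteq> K c \<union> K c'"
      using subgroup_cover[OF K_sub[OF cd(1)] K_sub[OF cd'(1)] C(1)] KC[OF cV(1)] KC[OF cV(2)] by blast
    then obtain e where e1: "e \<in> C" "e \<notin> K c" "e \<notin> K c'" by blast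
    have e: "e \<in> C" "c \<otimes> e \<noteq> e \<otimes> c" "c' \<otimes> e \<noteq> e \<otimes> c'"
      using e1 K_mem[OF cd(1)] K_mem[OF cd'(1)] by blast+
    have "k c d = k c e" by (rule k_const[OF cd e(1,2)])
    also have "\<dots> = inv (k e c)" by (rule k_inv[OF e(1) cd(1)])
    also have "k e c = k e c'"
      by (rule k_const[OF e(1) cd(1) not_sym[OF e(2)] cd'(1) not_sym[OF e(3)]])
    also have "inv (k e c') = k c' e" by (rule k_inv[OF e(1) cd'(1), symmetric])
    also have "k c' e = k c' d'" by (rule k_const[OF cd'(1) e(1,3) cd'(2,3)])
    finally show ?thesis .
  qed
  define w where "w = k a0 b0"
  have wV: "w \<in> V" using a0 b0 k_V by (simp add: w_def)
  have wc [simp]: "w \<in> carrier G" using wV by simp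
  \<comment> \<open>Conjugation by g takes a0, b0 to another noncommuting pair of C, whose
    commutator is w again.\<close>
  have "cj g w = w" if g: "g \<in> carrier G" for g
  proof -
    have a0c: "a0 \<in> carrier G" "b0 \<in> carrier G" using a0 b0 by simp_all
    have "cj g (a0 \<otimes> b0) \<noteq> cj g (b0 \<otimes> a0)" using nc0 a0c g by (metis cj_inv(2) m_closed)
    then have "cj g a0 \<otimes> cj g b0 \<noteq> cj g b0 \<otimes> cj g a0" using g a0c by (simp add: cj_mult)
    then have "k (cj g a0) (cj g b0) = w"
      unfolding w_def using a0 b0 nc0 g by (intro k_all normal)
    moreover have "k (cj g a0) (cj g b0) = cj g w"
      using g a0c by (simp add: w_def k_def cj_def inv_mult_group m_assoc)
    ultimately show ?thesis by simp
  qed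
  then have "w \<in> center" by (auto simp: center_def cj_eq_iff)
  moreover have "w \<noteq> \<one>"
    using nc0 a0 b0 by (auto simp: w_def k_def inv_solve_left' cj_eq_iff)
  ultimately have wz: "w = z" using center_eq by auto
  have C_class: "cj d c = c \<or> cj d c = c \<otimes> z" if c: "c \<in> C" and d: "d \<in> C" for c d
  proof (cases "c \<otimes> d = d \<otimes> c")
    case True
    then show ?thesis using c d by (simp add: cj_eq_iff)
  next
    case False
    then have "k c d = z" using k_all[OF c d False a0 b0 nc0] wz by (simp add: w_def)
    then have "c \<otimes> k c d = c \<otimes> z" by simp
    then show ?thesis using c d by (simp add: k_def)
  qed
  have u_class: "cj g u = u \<otimes> z" if g: "g \<in> carrier G - C" for g
  proof -
    have gc [simp]: "g \<in> carrier G" using g by simp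
    \<comment> \<open>V is the centre of the normal subgroup C and hence stable under conjugation;
      1, z and u itself are then excluded.\<close>
    have "cj g u \<in> V"
      unfolding V_def
    proof (intro CollectI conjI ballI)
      show "cj g u \<in> C" using normal uC by simp
      fix c assume c: "c \<in> C"
      define c' where "c' = cj (inv g) c"
      have c': "c' \<in> C" "c = cj g c'" using c normal by (simp_all add: c'_def)
      then have "cj g (u \<otimes> c') = cj g (c' \<otimes> u)" using u_comm by simp
      then show "cj g u \<otimes> c = c \<otimes> cj g u" using c' by (simp add: cj_mult)
    qed
    moreover have "cj g u \<noteq> u"
    proof
      assume "cj g u = u"
      then have "u \<otimes> g = g \<otimes> u" by (simp add: cj_eq_iff)
      then have "g \<in> C" unfolding C_def centralizer_def by simp
      then show False using g by simp
    qed
    moreover have "cj g u \<noteq> \<one>"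
    proof
      assume "cj g u = \<one>"
      then have "cj (inv g) \<one> = u" using cj_inv(2)[OF gc u] by (simp only:)
      then show False using u1 by simp
    qed
    moreover have "cj g u \<noteq> z"
    proof
      assume "cj g u = z"
      then have "cj (inv g) z = u" using cj_inv(2)[OF gc u] by (simp only:)
      moreover have "cj (inv g) z = z" by (simp add: cj_eq_iff z_comm)
      ultimately show False using u1 by simp
    qed
    ultimately show ?thesis unfolding V_eq by blast
  qed
  have "small_center G C u z"
  proof (intro small_center.intro small_center_axioms.intro group_axioms)
    show "subgroup C G" "\<And>g c. g \<in> carrier G \<Longrightarrow> c \<in> C \<Longrightarrow> cj g c \<in> C"
      "\<And>g h. g \<in> carrier G - C \<Longrightarrow> h \<in> carrier G - C \<Longrightarrow> g \<otimes> h \<in> C"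
      by (rule C normal index2_mult[OF C]; assumption)+
    show "\<exists>a\<in>C. \<exists>b\<in>C. a \<otimes> b \<noteq> b \<otimes> a" using a0 b0 nc0 by blast
    show "v \<in> {\<one>, z, u, u \<otimes> z}" if "v \<in> C" "\<And>c. c \<in> C \<Longrightarrow> v \<otimes> c = c \<otimes> v" for v
      using that unfolding V_eq[symmetric] by (simp add: V_def)
    show "d \<in> {\<one>, z, u, u \<otimes> z} \<or> inv c \<otimes> d \<in> {\<one>, z, u, u \<otimes> z}"
      if "c \<in> C" "d \<in> C" "c \<otimes> d = d \<otimes> c" "c \<notin> {\<one>, z, u, u \<otimes> z}" for c d
      using commute that unfolding V_eq[symmetric] by blast
  qed (fact z zc zz z_comm uC u1 zC u_comm C_class u_class)+
  then show ?thesis by (auto simp: C_def)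
qed

lemma class_hom_inner_or_order8:
  assumes f: "class_hom f"
  shows "inner f \<or> order8_gens"
proof (cases "center = carrier G")
  case True
  have "f x = cj \<one> x" if x: "x \<in> carrier G" for x
  proof -
    obtain g where "g \<in> carrier G" "f x = cj g x" using f x unfolding class_hom_def by blast
    moreover have "cj g x = x" if "g \<in> carrier G" for g
      using center_commute[of x g] True x that by (simp add: cj_eq_iff)
    ultimately show ?thesis using x by simp
  qed
  then have "inner f" unfolding inner_def by blast
  then show ?thesis ..
next
  case False
  then obtain u where u: "u \<in> carrier G" "card (centralizer u) = 16"
    using exists_index2_centralizer by blast
  show ?thesis
  proof (cases "\<exists>a\<in>centralizer u. \<exists>b\<in>centralizer u. a \<otimes> b \<noteq> b \<otimes> a")
    case True
    then obtain z where "small_center G (centralizer u) u z"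
      using small_center_if_nonabelian_centralizer[OF u] by blast
    moreover have "centralizer u \<noteq> carrier G" using u card_carrier by auto
    ultimately show ?thesis using small_center.inner_or_order8[of G "centralizer u" u z f] f by blast
  next
    case False
    then show ?thesis
      using inner_if_abelian_index2[OF f subgroup_centralizer[OF u(1)] u(2)] by blast
  qed
qed

lemma Aut_c_eq_Inn_or_order8: "Aut_c G = Inn G \<or> order8_gens"
proof (rule disjCI)
  assume no: "\<not> order8_gens"
  have "\<alpha> \<in> Inn G" if \<alpha>: "\<alpha> \<in> Aut_c G" for \<alpha>
  proof -
    have hom: "\<alpha> \<in> hom G G" and ext: "\<alpha> \<in> extensional (carrier G)"
      using \<alpha> by (auto simp: Aut_c_def auto_def Bij_def)
    have "\<exists>g\<in>carrier G. \<alpha> x = cj g x" if x: "x \<in> carrier G" for x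
    proof -
      have ax: "\<alpha> x \<in> carrier G" using hom x by (auto simp: hom_def)
      \<comment> \<open>\<open>Aut_c\<close> conjugates the image to the point,
        \<open>class_hom\<close> the point to the image, so the inverse of g is the witness.\<close>
      obtain g where g: "g \<in> carrier G" "x = cj g (\<alpha> x)"
        using \<alpha> x unfolding Aut_c_def conjugate_in_def cj_def by blast
      have "\<alpha> x = cj (inv g) (cj g (\<alpha> x))" using g(1) ax by simp
      then have "\<alpha> x = cj (inv g) x" by (simp only: g(2)[symmetric])
      then show ?thesis using g(1) by blast
    qed
    then have "class_hom \<alpha>" using hom by (simp add: class_hom_def)
    then obtain g where g: "g \<in> carrier G" "\<And>x. x \<in> carrier G \<Longrightarrow> \<alpha> x = cj g x"
      using class_hom_inner_or_order8 no unfolding inner_def by blast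
    then have "\<alpha> = (\<lambda>x\<in>carrier G. inv g \<otimes> x \<otimes> g)"
      using ext by (intro extensionalityI[of \<alpha> "carrier G"]) (simp_all add: cj_def)
    then show ?thesis using g(1) by (auto simp: Inn_def)
  qed
  then show "Aut_c G = Inn G" using Inn_subset_Aut_c by blast
qed

end

lemma Aut_c_eq_Inn_if_not_phi6:
  fixes G :: "('a, 'b) monoid_scheme"
  assumes G: "group G" "order G = 32" and no: "\<not> G \<cong> G44" "\<not> G \<cong> G45"
  shows "Aut_c G = Inn G"
proof -
  interpret group32 G using G by (simp add: group32_def group32_axioms_def)
  have "\<not> order8_gens"
  proof
    assume order8_gens
    then obtain e where "model e \<cong> G"
      unfolding order8_gens_def using iso_model_if_order8[OF order32] by blast
    then have "G \<cong> model e" by (rule group.iso_sym[OF group_model])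
    then have "G \<cong> G44 \<or> G \<cong> G45"
      using iso_trans[OF _ G44_iso] iso_trans[OF _ G45_iso] by (cases e) auto
    then show False using no by blast
  qed
  then show ?thesis using Aut_c_eq_Inn_or_order8 by blast
qed

theorem theorem4p2:
  shows "(\<forall>G :: ('a, 'b) monoid_scheme.
            group G \<and> order G = 32 \<and> \<not> G \<cong> G44 \<and> \<not> G \<cong> G45 \<longrightarrow> Aut_c G = Inn G)
         \<and> Aut_c G44 \<noteq> Inn G44
         \<and> Aut_c G45 \<noteq> Inn G45"
  using Aut_c_eq_Inn_if_not_phi6 G44_exotic G45_exotic by blast

end
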